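(* Let $K\in\mathbb N$ with $1\le K<N=\min(p,q)$ be given, let $F$ be a fixed complex $p\times q$ matrix, and let $\phi=(\phi_j)_{j=1}^N$, $\phi_1\ge\phi_2\ge\dots\ge\phi_N\ge0$, be its singular values. Let $\phi_J$ (respectively $\phi_L$) be the first (respectively last) singular value that equals $\phi_K$, and set $M=L+1-J$ (that is, the multiplicity of $\phi_K$). Finally set $m=K+1-J$ (that is, the multiplicity of $\phi_K$ in the truncated list $\phi_1,\dots,\phi_K$). Let $\mathcal I(A)=\mathcal R_K(A)+\|A-F\|^2$ and let $\mathcal I^{**}$ be its convex envelope. Then: (1) The global minima of $\mathcal I$ and of $\mathcal I^{**}$ both equal $\sum_{j>K}\phi_j^2$. (2) The solutions to $\operatorname{argmin}_A\mathcal I^{**}(A)$ are all matrices of the form $A_*=U\Sigma_\alpha V^*$, where $U\Sigma_\phi V^*$ is any singular value decomposition of $F$ and $\alpha=(\alpha_j)_{j=1}^N$ is a decreasing sequence satisfying $$\alpha_j=\phi_j\ \text{ for } 1\le j<J,\qquad (\alpha_j)_{j=J}^{L}\in\phi_K\,\Omega_{M,m},\qquad \alpha_j=0\ \text{ for } j>L .$$ (3) In particular, $A_*$ is unique if and only if $\phi_K$ has multiplicity one. Also, the maximal rank of such an $A_*$ is $L$ and the minimal rank is $J$.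
   Context: $\|\cdot\|$ is the Frobenius norm on complex $p\times q$ matrices. $\mathcal R_K(A)=0$ if $\operatorname{rank}A\le K$ and $\mathcal R_K(A)=+\infty$ otherwise. The convex envelope $\mathcal I^{**}$ of $\mathcal I$ is the largest convex function that is pointwise $\le\mathcal I$ (the Fenchel bi-conjugate of $\mathcal I$). For a sequence $\alpha=(\alpha_j)_{j=1}^N$, $\Sigma_\alpha$ is the $N\times N$ diagonal matrix with diagonal entries $\alpha_1,\dots,\alpha_N$. A singular value decomposition of $F$ is a factorization $F=U\Sigma_\phi V^*$ with $U\in\mathbb C^{p\times N}$, $V\in\mathbb C^{q\times N}$, $U^*U=V^*V=I_N$, and $\phi$ the decreasing sequence of singular values of $F$. "Decreasing" is meant in the weak sense (nonincreasing). For integers $m\le M$, $\Omega_{M,m}\subset\mathbb R^M$ is the simplex of all $x\in\mathbb R^M$ with $\sum_{j=1}^M x_j=m$ and $1\ge x_1\ge x_2\ge\dots\ge x_M\ge0$; and $\phi_K\Omega_{M,m}=\{\phi_K x: x\in\Omega_{M,m}\}$.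
   Formalization: Part (3) is false as printed (e.g. F=diag(1,1,0), K=2) and is corrected: A_* is unique iff L=K or φ_K=0 (in particular if φ_K has multiplicity one), and if φ_K>0 the maximal rank is L and the minimal rank is K, which is J only when J=K. *)

theory Defs
  imports "HOL-Analysis.Analysis"
begin

text \<open>
  A complex \<open>p \<times> q\<close> matrix is an element of \<^typ>\<open>complex^'q^'p\<close>. The library norm on this type
  is the iterated Euclidean norm of the entries, i.e. the Frobenius norm. All finite sequences
  are functions on \<^typ>\<open>nat\<close> of which only the values at \<open>1, \<dots>, N\<close> are used.
\<close>

definition ctransp :: "complex^'n^'m \<Rightarrow> complex^'m^'n" where
  "ctransp A = (\<chi> i j. cnj (A $ j $ i))"

lemma norm_frobenius:
  fixes A :: "complex^'q^'p"
  shows "norm A = sqrt (\<Sum>i\<in>UNIV. \<Sum>j\<in>UNIV. (cmod (A $ i $ j))\<^sup>2)"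
  by (simp add: norm_vec_def L2_set_def sum_nonneg)


subsection \<open>Singular values and singular value decompositions\<close>

text \<open>
  The \<open>\<phi> j\<close> are the square roots of the \<open>N = min p q\<close> largest eigenvalues of the Hermitian
  matrix \<open>F\<^sup>* F\<close>, with multiplicity. It suffices to prescribe the multiplicities of the positive
  values: they add up to at most \<open>N\<close>, and the remaining entries have to vanish.
\<close>
definition singular_values :: "complex^'q^'p \<Rightarrow> (nat \<Rightarrow> real) \<Rightarrow> bool" where
  "singular_values F \<phi> \<longleftrightarrow>
     (let N = min CARD('p) CARD('q) in
        antimono_on {1..N} \<phi> \<and> (\<forall>j\<in>{1..N}. 0 \<le> \<phi> j) \<and>
        (\<forall>s>0. card {j\<in>{1..N}. \<phi> j = s} =
               vec.dim {x. (ctransp F ** F) *v x = complex_of_real (s\<^sup>2) *s x}))"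

text \<open>
  An index type of size \<open>N\<close> is identified with \<open>{1..N}\<close> by means of its linear order.
\<close>
definition pos :: "'n::{finite,linorder} \<Rightarrow> nat" where
  "pos i = card {..i}"

lemma strict_mono_pos: "strict_mono (pos :: 'n::{finite,linorder} \<Rightarrow> nat)"
  unfolding pos_def by (intro strict_monoI psubset_card_mono) auto

lemma bij_betw_pos: "bij_betw pos (UNIV :: 'n::{finite,linorder} set) {1..CARD('n)}"
proof -
  have inj: "inj (pos :: 'n \<Rightarrow> nat)"
    using strict_mono_pos strict_mono_imp_inj_on by blast
  have "pos i \<in> {1..CARD('n)}" for i :: 'n
    unfolding pos_def by (auto simp: Suc_le_eq card_gt_0_iff intro: card_mono)
  then have "range (pos :: 'n \<Rightarrow> nat) \<subseteq> {1..CARD('n)}" by auto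
  moreover have "card (range (pos :: 'n \<Rightarrow> nat)) = card {1..CARD('n)}"
    using inj by (simp add: card_image)
  ultimately have "range (pos :: 'n \<Rightarrow> nat) = {1..CARD('n)}"
    by (intro card_subset_eq) auto
  with inj show ?thesis by (simp add: bij_betw_def)
qed

definition diag_mat :: "(nat \<Rightarrow> real) \<Rightarrow> complex^('n::{finite,linorder})^('n::{finite,linorder})" where
  "diag_mat \<alpha> = (\<chi> i j. if i = j then complex_of_real (\<alpha> (pos i)) else 0)"

definition is_svd ::
  "complex^'q^'p \<Rightarrow> complex^('n::{finite,linorder})^'p \<Rightarrow> (nat \<Rightarrow> real) \<Rightarrow>
    complex^('n::{finite,linorder})^'q \<Rightarrow> bool" where
  "is_svd F U \<phi> V \<longleftrightarrow>
     CARD('n) = min CARD('p) CARD('q) \<and>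
     ctransp U ** U = mat 1 \<and> ctransp V ** V = mat 1 \<and>
     singular_values F \<phi> \<and> F = U ** diag_mat \<phi> ** ctransp V"


subsection \<open>Convex envelopes\<close>

text \<open>
  In \<^typ>\<open>ereal\<close> one has \<open>\<infinity> + (- \<infinity>) = \<infinity>\<close>, so the inequality below is convexity of the
  epigraph also for functions taking the value \<open>- \<infinity>\<close>. The endpoints \<open>t = 0\<close> and \<open>t = 1\<close> are
  left out as they carry no information.
\<close>
definition ereal_convex :: "('a::real_vector \<Rightarrow> ereal) \<Rightarrow> bool" where
  "ereal_convex f \<longleftrightarrow>
     (\<forall>x y t. 0 < t \<and> t < 1 \<longrightarrow>
        f ((1 - t) *\<^sub>R x + t *\<^sub>R y) \<le> ereal (1 - t) * f x + ereal t * f y)"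

definition convex_envelope :: "('a::real_vector \<Rightarrow> ereal) \<Rightarrow> 'a \<Rightarrow> ereal" where
  "convex_envelope f x = (SUP g\<in>{g. ereal_convex g \<and> g \<le> f}. g x)"

lemma convex_envelope_greatest:
  shows "ereal_convex (convex_envelope f)" and "convex_envelope f \<le> f"
    and "\<And>g. ereal_convex g \<Longrightarrow> g \<le> f \<Longrightarrow> g \<le> convex_envelope f"
proof -
  show upper: "g \<le> convex_envelope f" if "ereal_convex g" "g \<le> f" for g
  proof (rule le_funI)
    fix x
    show "g x \<le> convex_envelope f x"
      unfolding convex_envelope_def using that by (intro SUP_upper) simp
  qed
  show "convex_envelope f \<le> f"
    by (rule le_funI) (auto simp: convex_envelope_def le_fun_def intro!: SUP_least)
  show "ereal_convex (convex_envelope f)"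
    unfolding ereal_convex_def
  proof (intro allI impI)
    fix x y :: 'a and t :: real
    assume t: "0 < t \<and> t < 1"
    show "convex_envelope f ((1 - t) *\<^sub>R x + t *\<^sub>R y)
          \<le> ereal (1 - t) * convex_envelope f x + ereal t * convex_envelope f y"
      unfolding convex_envelope_def[of f "(1 - t) *\<^sub>R x + t *\<^sub>R y"]
    proof (rule SUP_least)
      fix g assume g: "g \<in> {g. ereal_convex g \<and> g \<le> f}"
      then have le: "g z \<le> convex_envelope f z" for z
        using upper by (auto simp: le_fun_def)
      have "g ((1 - t) *\<^sub>R x + t *\<^sub>R y) \<le> ereal (1 - t) * g x + ereal t * g y"
        using g t by (auto simp: ereal_convex_def)
      also have "\<dots> \<le> ereal (1 - t) * convex_envelope f x + ereal t * convex_envelope f y"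
        using t by (intro add_mono ereal_mult_left_mono le) auto
      finally show "g ((1 - t) *\<^sub>R x + t *\<^sub>R y)
          \<le> ereal (1 - t) * convex_envelope f x + ereal t * convex_envelope f y" .
    qed
  qed
qed

definition argmin :: "('a \<Rightarrow> ereal) \<Rightarrow> 'a set" where
  "argmin f = {x. is_arg_min f (\<lambda>_. True) x}"

definition has_global_min :: "('a \<Rightarrow> ereal) \<Rightarrow> ereal \<Rightarrow> bool" where
  "has_global_min f c \<longleftrightarrow> (\<exists>x\<in>argmin f. f x = c)"


subsection \<open>The fixed rank functional and the simplex\<close>

definition rank_indicator :: "nat \<Rightarrow> complex^'q^'p \<Rightarrow> ereal" where
  "rank_indicator K A = (if rank A \<le> K then 0 else \<infinity>)"

definition rank_functional :: "nat \<Rightarrow> complex^'q^'p \<Rightarrow> complex^'q^'p \<Rightarrow> ereal" where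
  "rank_functional K F A = rank_indicator K A + ereal ((norm (A - F))\<^sup>2)"

definition Omega :: "nat \<Rightarrow> nat \<Rightarrow> (nat \<Rightarrow> real) set" where
  "Omega M m = {x. (\<Sum>j=1..M. x j) = real m \<and>
                   (\<forall>j\<in>{1..M}. 0 \<le> x j \<and> x j \<le> 1) \<and> antimono_on {1..M} x}"

end

theory Submission
  imports Defs
begin

text \<open>
  Write \<open>c\<close> for the sum of the \<open>\<phi> j\<^sup>2\<close> with \<open>j > K\<close> and \<open>\<langle>X, Y\<rangle>\<close> for the real Frobenius inner product.

  If \<open>B\<close> has rank at most \<open>K\<close>, let \<open>Q\<close> be the orthogonal projection with \<open>B Q = B\<close> onto the range of
  the adjoint of \<open>B\<close>. Pythagoras gives
  \<open>\<parallel>B - F\<parallel>\<^sup>2 = \<parallel>B - F Q\<parallel>\<^sup>2 + \<parallel>F\<parallel>\<^sup>2 - \<langle>F, F Q\<rangle>\<close>.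
  The right-hand side is jointly convex in \<open>(B, Q)\<close> and makes sense for every Hermitian \<open>Q\<close> with
  \<open>0 \<le> Q \<le> 1\<close> and trace at most \<open>K\<close>. These \<open>Q\<close> form a compact convex set, so the minimum over
  \<open>Q\<close> is attained and is a convex function of \<open>B\<close>. It lies below \<open>I\<close>, hence below the convex envelope
  (\<open>convex_envelope_lower_bound\<close>).

  For a singular value decomposition \<open>F = U \<Sigma> V\<^sup>*\<close> the term \<open>\<langle>F, F Q\<rangle>\<close> is the sum of the
  \<open>\<phi> j\<^sup>2 h j\<close>, where the weights \<open>h j\<close> are the diagonal entries of \<open>H = V\<^sup>* Q V\<close>; they lie in
  \<open>[0, 1]\<close> and add up to at most \<open>K\<close>. The sum is largest when all weight sits on the \<open>K\<close> largest
  singular values, so the envelope is at least \<open>c\<close>. If it equals \<open>c\<close> at \<open>A\<close>, then \<open>A = F Q\<close> with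
  extremal weights: \<open>1\<close> where \<open>\<phi> j > \<phi> K\<close>, \<open>0\<close> where \<open>\<phi> j < \<phi> K\<close>, and of total \<open>K\<close> when
  \<open>\<phi> K > 0\<close>. Since \<open>0 \<le> H \<le> 1\<close>, the weights \<open>1\<close> and \<open>0\<close> force \<open>H\<close> to act as identity and as zero on
  the corresponding basis vectors. For \<open>\<phi> K = 0\<close> this leaves only \<open>A = F\<close>; for \<open>\<phi> K > 0\<close> it gives
  \<open>A = U \<Sigma> H V\<^sup>*\<close> (\<open>envelope_analysis\<close>), where only the block of \<open>H\<close> belonging to \<open>\<phi> K\<close> is free. A unitary matrix diagonalising that block commutes with \<open>\<Sigma>\<close>, so it turns
  \<open>(U, V)\<close> into another singular value decomposition of \<open>F\<close>, in which \<open>A\<close> has the asserted form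
  (\<open>minimiser_has_optimal_svd\<close>).

  Conversely, a point of the simplex is a convex combination of \<open>0/1\<close>-vectors of the same sum
  (\<open>hypersimplex_vertices\<close>). Those vectors belong to matrices of rank at most \<open>K\<close> with \<open>I = c\<close>, and the
  sublevel sets of the envelope are convex (\<open>optimal_sequence_value\<close>). Ranks are counted from the
  nonzero entries of \<open>\<alpha>\<close>. If \<open>L = K\<close> the trace condition forces the free block to be the identity,
  which gives uniqueness; if \<open>L > K\<close> and \<open>\<phi> K > 0\<close>, both ranks \<open>K\<close> and \<open>L\<close> occur.
\<close>

section \<open>The Hermitian form and adjoints\<close>

text \<open>
  The library inner product on \<^typ>\<open>complex^'n\<close> is real; it is the real part of this form.
\<close>
definition cdot :: "complex^'n \<Rightarrow> complex^'n \<Rightarrow> complex" where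
  "cdot x y = (\<Sum>i\<in>UNIV. cnj (x $ i) * y $ i)"

lemma Re_cdot: "Re (cdot x y) = x \<bullet> y"
  by (simp add: cdot_def inner_vec_def inner_complex_def)

lemma cnj_cdot: "cnj (cdot x y) = cdot y x"
  by (simp add: cdot_def mult.commute)

lemma cdot_self: "cdot x x = of_real ((norm x)\<^sup>2)"
  by (simp add: cdot_def norm_vec_def L2_set_def sum_nonneg complex_norm_square mult.commute
      del: of_real_power)

lemma cdot_add_right: "cdot x (y + z) = cdot x y + cdot x z"
  and cdot_diff_right: "cdot x (y - z) = cdot x y - cdot x z"
  and cdot_smult_right: "cdot x (c *s y) = c * cdot x y"
  and cdot_smult_left: "cdot (c *s x) y = cnj c * cdot x y"
  and cdot_zero_right [simp]: "cdot x 0 = 0"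
  and cdot_zero_left [simp]: "cdot 0 y = 0"
  by (simp_all add: cdot_def sum.distrib algebra_simps sum_subtractf sum_distrib_left)

lemma cdot_sum_right: "cdot x (\<Sum>i\<in>A. f i) = (\<Sum>i\<in>A. cdot x (f i))"
  by (induction A rule: infinite_finite_induct) (simp_all add: cdot_add_right)

lemma cdot_axis_left: "cdot (axis i 1) x = x $ i"
proof -
  have "cnj (axis i 1 $ j) * x $ j = (if j = i then x $ j else 0)" for j
    by (simp add: axis_def)
  then show ?thesis by (simp add: cdot_def)
qed

lemma cdot_axis_axis: "cdot (axis i 1) (axis j 1) = (if i = j then 1 else 0)"
  by (simp add: cdot_axis_left) (simp add: axis_def)

lemma ctransp_ctransp [simp]: "ctransp (ctransp A) = A"
  by (simp add: ctransp_def vec_eq_iff)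

lemma ctransp_mult: "ctransp (A ** B) = ctransp B ** ctransp A"
  by (simp add: ctransp_def vec_eq_iff matrix_matrix_mult_def mult.commute)

lemma ctransp_mat1 [simp]: "ctransp (mat 1) = mat 1"
  by (simp add: ctransp_def vec_eq_iff mat_def)

lemma ctransp_add: "ctransp (A + B) = ctransp A + ctransp B"
  and ctransp_diff: "ctransp (A - B) = ctransp A - ctransp B"
  and ctransp_scaleR: "ctransp (r *\<^sub>R A) = r *\<^sub>R ctransp A"
  by (simp_all add: ctransp_def vec_eq_iff)

lemma ctransp_diag_mat [simp]: "ctransp (diag_mat \<alpha>) = diag_mat \<alpha>"
  by (simp add: ctransp_def vec_eq_iff diag_mat_def)

lemma cdot_adjoint: "cdot (A *v x) y = cdot x (ctransp A *v y)"
proof -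
  have "cdot (A *v x) y = (\<Sum>i\<in>UNIV. \<Sum>j\<in>UNIV. cnj (A $ i $ j) * cnj (x $ j) * y $ i)"
    by (simp add: cdot_def matrix_vector_mult_def sum_distrib_right)
  also have "\<dots> = (\<Sum>j\<in>UNIV. \<Sum>i\<in>UNIV. cnj (A $ i $ j) * cnj (x $ j) * y $ i)"
    by (rule sum.swap)
  also have "\<dots> = cdot x (ctransp A *v y)"
    by (simp add: cdot_def matrix_vector_mult_def ctransp_def sum_distrib_left mult.assoc mult.left_commute)
  finally show ?thesis .
qed

lemma inner_adjoint: "(A *v x) \<bullet> y = x \<bullet> (ctransp A *v y)"
  by (metis Re_cdot cdot_adjoint)

lemma matrix_vector_mult_smult: "A *v (c *s x) = c *s (A *v (x :: complex^'n))"
  by (simp add: vec_eq_iff matrix_vector_mult_def sum_distrib_left mult.left_commute)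

lemma matrix_vector_scaleR: "A *v (r *\<^sub>R x) = r *\<^sub>R (A *v (x :: complex^'n))"
  by (simp add: vec_eq_iff matrix_vector_mult_def scaleR_sum_right)

lemma ctransp_mult_entry: "(ctransp A ** B) $ i $ j = cdot (column i A) (column j B)"
  by (simp add: ctransp_def matrix_matrix_mult_def cdot_def column_def)

lemma isometry_iff_columns:
  "ctransp U ** U = mat 1 \<longleftrightarrow>
     (\<forall>i j. cdot (column i U) (column j U) = (if i = j then 1 else 0))"
  by (simp add: vec_eq_iff ctransp_mult_entry mat_def)

lemma trace_diff: "trace (A - B) = trace A - trace (B :: complex^'n^'n)"
  and trace_add: "trace (A + B) = trace A + trace (B :: complex^'n^'n)"
  and trace_scaleR: "trace (r *\<^sub>R A) = of_real r * trace (A :: complex^'n^'n)"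
  by (simp_all add: trace_def sum_subtractf sum.distrib sum_distrib_left scaleR_conv_of_real[of _ "_ :: complex"])

lemma scaleR_matrix_mult: "(r *\<^sub>R A) ** B = r *\<^sub>R (A ** B)"
  and matrix_mult_scaleR: "A ** (r *\<^sub>R B) = r *\<^sub>R (A ** (B :: complex^'n^'m))"
  by (simp_all add: vec_eq_iff matrix_matrix_mult_def scaleR_sum_right)

lemma matrix_diff_ldistrib: "A ** (B - C) = A ** B - A ** (C :: complex^'n^'m)"
  and matrix_diff_rdistrib: "(A' - B') ** C' = A' ** C' - B' ** (C' :: complex^'n^'m)"
  and matrix_add_rdistrib': "(A' + B') ** C' = A' ** C' + B' ** (C' :: complex^'n^'m)"
  by (simp_all add: vec_eq_iff matrix_matrix_mult_def algebra_simps sum_subtractf sum.distrib)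

lemma inner_matrix_trace: "X \<bullet> Y = Re (trace (ctransp X ** Y))"
  for X Y :: "complex^'n^'m"
proof -
  have "X \<bullet> Y = (\<Sum>i\<in>UNIV. \<Sum>j\<in>UNIV. Re (cnj (X $ i $ j) * Y $ i $ j))"
    by (simp add: inner_vec_def inner_complex_def)
  also have "\<dots> = (\<Sum>j\<in>UNIV. \<Sum>i\<in>UNIV. Re (cnj (X $ i $ j) * Y $ i $ j))"
    by (rule sum.swap)
  finally show ?thesis by (simp add: trace_def matrix_matrix_mult_def ctransp_def)
qed

lemma inner_matrix_left: "(A ** X) \<bullet> Y = X \<bullet> (ctransp A ** Y)"
  for X :: "complex^'n^'m" and A :: "complex^'m^'k"
  by (simp add: inner_matrix_trace ctransp_mult matrix_mul_assoc)

lemma inner_matrix_right: "(X ** A) \<bullet> Y = X \<bullet> (Y ** ctransp A)"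
  for X :: "complex^'n^'m" and A :: "complex^'k^'n"
proof -
  have "(X ** A) \<bullet> Y = Re (trace (ctransp A ** (ctransp X ** Y)))"
    by (simp add: inner_matrix_trace ctransp_mult matrix_mul_assoc)
  also have "\<dots> = Re (trace ((ctransp X ** Y) ** ctransp A))"
    by (simp only: trace_mul_sym[of "ctransp A"])
  finally show ?thesis by (simp add: inner_matrix_trace matrix_mul_assoc)
qed

lemma inner_matrix_columns: "X \<bullet> Y = (\<Sum>j\<in>UNIV. column j X \<bullet> column j Y)"
  for X Y :: "complex^'n^'m"
proof -
  have "X \<bullet> Y = (\<Sum>i\<in>UNIV. \<Sum>j\<in>UNIV. X $ i $ j \<bullet> Y $ i $ j)"
    by (simp add: inner_vec_def)
  also have "\<dots> = (\<Sum>j\<in>UNIV. \<Sum>i\<in>UNIV. X $ i $ j \<bullet> Y $ i $ j)"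
    by (rule sum.swap)
  finally show ?thesis by (simp add: inner_vec_def column_def)
qed

lemma column_matrix_mult: "column j (A ** B) = A *v column j B"
  by (simp add: vec_eq_iff column_def matrix_matrix_mult_def matrix_vector_mult_def)

lemma matrix_eq_columnsI: "(\<And>j. column j A = column j B) \<Longrightarrow> A = B"
  by (simp add: vec_eq_iff column_def)

lemma isometry_norm:
  assumes "ctransp U ** U = mat 1"
  shows "norm (U *v x) = norm x"
proof -
  have "(U *v x) \<bullet> (U *v x) = x \<bullet> x"
    by (simp add: inner_adjoint matrix_vector_mul_assoc assms)
  then show ?thesis by (simp add: norm_eq_sqrt_inner)
qed

lemma coisometry_norm_le:
  assumes "ctransp U ** U = mat 1"
  shows "norm (ctransp U *v x) \<le> norm x"
proof -
  have "(norm (ctransp U *v x))\<^sup>2 = x \<bullet> (U *v (ctransp U *v x))"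
    by (simp add: power2_norm_eq_inner inner_adjoint)
  also have "\<dots> \<le> norm x * norm (U *v (ctransp U *v x))"
    by (rule norm_cauchy_schwarz)
  also have "\<dots> = norm x * norm (ctransp U *v x)"
    by (simp add: isometry_norm assms)
  finally show ?thesis
    by (cases "norm (ctransp U *v x) = 0") (auto simp: power2_eq_square)
qed

section \<open>Orthonormal families\<close>

definition orthonormal_on :: "'i set \<Rightarrow> ('i \<Rightarrow> complex^'n) \<Rightarrow> bool" where
  "orthonormal_on A w \<longleftrightarrow> (\<forall>i\<in>A. \<forall>j\<in>A. cdot (w i) (w j) = (if i = j then 1 else 0))"

lemma orthonormal_onD:
  "orthonormal_on A w \<Longrightarrow> i \<in> A \<Longrightarrow> j \<in> A \<Longrightarrow> cdot (w i) (w j) = (if i = j then 1 else 0)"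
  by (simp add: orthonormal_on_def)

lemma orthonormal_on_norm: "orthonormal_on A w \<Longrightarrow> i \<in> A \<Longrightarrow> norm (w i) = 1"
  using orthonormal_onD[of A w i i] Re_cdot[of "w i" "w i"] by (simp add: norm_eq_1)

lemma orthonormal_on_coeff:
  assumes "orthonormal_on A w" "finite A" "i \<in> A"
  shows "cdot (w i) (\<Sum>j\<in>A. c j *s w j) = c i"
proof -
  have "cdot (w i) (\<Sum>j\<in>A. c j *s w j) = (\<Sum>j\<in>A. c j * (if i = j then 1 else 0))"
    unfolding cdot_sum_right cdot_smult_right
    using assms by (intro sum.cong) (auto simp: orthonormal_onD)
  also have "\<dots> = c i" using assms by (simp add: if_distrib cong: if_cong)
  finally show ?thesis .
qed

lemma orthonormal_on_inj: "orthonormal_on A w \<Longrightarrow> inj_on w A"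
  unfolding inj_on_def orthonormal_on_def by (metis zero_neq_one)

lemma orthonormal_on_independent:
  assumes "orthonormal_on A w" "finite A"
  shows "vec.independent (w ` A)"
proof (rule vec.independent_if_scalars_zero)
  show "finite (w ` A)" using assms by simp
next
  fix f x assume s: "(\<Sum>x\<in>w ` A. f x *s x) = 0" and "x \<in> w ` A"
  then obtain i where i: "i \<in> A" "x = w i" by auto
  have "(\<Sum>j\<in>A. f (w j) *s w j) = 0"
    using s by (simp add: sum.reindex[OF orthonormal_on_inj[OF assms(1)]])
  then have "cdot (w i) (\<Sum>j\<in>A. f (w j) *s w j) = 0" by simp
  then show "f x = 0" using orthonormal_on_coeff[OF assms i(1)] i by simp
qed

lemma dim_span_orthonormal:
  assumes "orthonormal_on A w" "finite A"
  shows "vec.dim (vec.span (w ` A)) = card A"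
  using assms by (simp add: vec.dim_eq_card_independent orthonormal_on_independent card_image
      orthonormal_on_inj)

lemma orthonormal_card_le:
  assumes "orthonormal_on A (w :: _ \<Rightarrow> complex^'n)" "finite A"
  shows "card A \<le> CARD('n)"
  using dim_span_orthonormal[OF assms] vec.dim_subset[of "vec.span (w ` A)" UNIV]
  by (simp only: vec_dim_card subset_UNIV)

text \<open>
  As long as there are fewer vectors than dimensions, some vector lies outside their span; removing
  its components and normalising what is left gives the next one.
\<close>
lemma orthonormal_extend:
  fixes w :: "nat \<Rightarrow> complex^'n"
  assumes "orthonormal_on {..<r} w" "r \<le> n" "n \<le> CARD('n)"
  shows "\<exists>w'. orthonormal_on {..<n} w' \<and> (\<forall>i<r. w' i = w i)"
  using assms(2,3)
proof (induction n rule: dec_induct)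
  case base
  then show ?case using assms(1) by auto
next
  case (step k)
  then obtain u where u: "orthonormal_on {..<k} u" "\<forall>i<r. u i = w i" by auto
  have "vec.span (u ` {..<k}) \<noteq> UNIV"
  proof
    assume "vec.span (u ` {..<k}) = UNIV"
    then have "k = CARD('n)"
      using dim_span_orthonormal[OF u(1)] vec_dim_card[where 'n = 'n and 'a = complex] by simp
    then show False using step.prems by simp
  qed
  then obtain x where x: "x \<notin> vec.span (u ` {..<k})" by auto
  let ?y = "x - (\<Sum>j<k. cdot (u j) x *s u j)"
  have y0: "?y \<noteq> 0"
  proof
    assume "?y = 0"
    then have "x = (\<Sum>j<k. cdot (u j) x *s u j)" by simp
    moreover have "\<dots> \<in> vec.span (u ` {..<k})"
      by (intro vec.span_sum vec.span_scale vec.span_base) auto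
    ultimately show False using x by simp
  qed
  have orth: "cdot (u i) ?y = 0" if "i < k" for i
    using orthonormal_on_coeff[OF u(1), of i "\<lambda>j. cdot (u j) x"] that
    by (simp add: cdot_diff_right)
  define y where "y = of_real (inverse (norm ?y)) *s ?y"
  have yy: "cdot y y = 1"
  proof -
    have "cdot y y = of_real (inverse (norm ?y) * (inverse (norm ?y) * (norm ?y)\<^sup>2))"
      unfolding y_def cdot_smult_left cdot_smult_right cdot_self[of ?y]
      by (simp only: of_real_mult complex_cnj_complex_of_real)
    also have "inverse (norm ?y) * (inverse (norm ?y) * (norm ?y)\<^sup>2) = 1"
      using y0 by (simp only: power2_eq_square norm_eq_zero field_simps) simp
    finally show ?thesis by simp
  qed
  have uy: "cdot (u i) y = 0" "cdot y (u i) = 0" if "i < k" for i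
  proof -
    show *: "cdot (u i) y = 0" using orth[OF that] unfolding y_def cdot_smult_right by simp
    then show "cdot y (u i) = 0" by (metis cnj_cdot complex_cnj_zero)
  qed
  have "orthonormal_on {..<Suc k} (u(k := y))"
    using u(1) yy uy by (auto simp: orthonormal_on_def less_Suc_eq)
  moreover have "\<forall>i<r. (u(k := y)) i = w i" using u(2) step.hyps by simp
  ultimately show ?case by blast
qed

section \<open>The spectral theorem\<close>

text \<open>
  The first-order condition at a maximum: for small positive \<open>t\<close> the linear term would win.
\<close>
lemma quadratic_bound_imp_zero:
  fixes a b :: real
  assumes "\<And>t. 2 * t * a \<le> t\<^sup>2 * b" "0 \<le> a"
  shows "a = 0"
proof (rule ccontr)
  assume "a \<noteq> 0"
  then have a: "a > 0" using assms(2) by simp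
  define t where "t = a / (\<bar>b\<bar> + 1)"
  have t: "t > 0" using a by (simp add: t_def)
  have "2 * t * a \<le> t\<^sup>2 * \<bar>b\<bar>" using assms(1)[of t] mult_left_mono[OF abs_ge_self[of b] zero_le_power2[of t]] by linarith
  then have "t * (2 * a) \<le> t * (t * \<bar>b\<bar>)" by (simp add: power2_eq_square mult_ac)
  then have "2 * a \<le> t * \<bar>b\<bar>" using t by simp
  also have "\<dots> \<le> t * (\<bar>b\<bar> + 1)" using t by (intro mult_left_mono) auto
  also have "\<dots> = a" by (simp add: t_def)
  finally show False using a by simp
qed

text \<open>
  A complex subspace is in particular a real one.
\<close>
lemma complex_subspace_closed:
  assumes "vec.subspace (S :: (complex^'n) set)"
  shows "closed S"
proof (rule closed_subspace)
  have "c *\<^sub>R x = complex_of_real c *s x" for c and x :: "complex^'n"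
    by (simp add: vec_eq_iff scaleR_conv_of_real[where 'a = complex])
  then show "subspace S"
    using assms by (auto simp: vec.subspace_def subspace_def)
qed

text \<open>
  The Rayleigh quotient attains its maximum on the unit sphere of \<open>S\<close>, and a maximiser is an
  eigenvector because the residual \<open>A w - l w\<close> is an admissible direction of variation.
\<close>
lemma spectral_max:
  fixes A :: "complex^'n^'n"
  assumes herm: "ctransp A = A" and S: "vec.subspace S" and inv: "\<And>x. x \<in> S \<Longrightarrow> A *v x \<in> S"
    and nz: "x0 \<in> S" "x0 \<noteq> 0"
  shows "\<exists>w\<in>S. \<exists>l. norm w = 1 \<and> A *v w = of_real l *s w \<and>
           (\<forall>x\<in>S. x \<bullet> (A *v x) \<le> l * (norm x)\<^sup>2)"
proof -
  have scaleR: "c *\<^sub>R x = complex_of_real c *s x" for c and x :: "complex^'n"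
    by (simp add: vec_eq_iff scaleR_conv_of_real[where 'a = complex])
  let ?f = "\<lambda>x. x \<bullet> (A *v x)"
  let ?C = "sphere 0 1 \<inter> S"
  have RS: "r *\<^sub>R x \<in> S" if "x \<in> S" for r x
    unfolding scaleR using S that by (simp add: vec.subspace_scale)
  have "compact ?C"
    by (intro compact_Int_closed compact_sphere complex_subspace_closed S)
  moreover have "?C \<noteq> {}"
  proof -
    have "inverse (norm x0) *\<^sub>R x0 \<in> ?C" using RS[OF nz(1)] nz(2) by simp
    then show ?thesis by blast
  qed
  moreover have "continuous_on ?C ?f"
    by (intro continuous_intros linear_continuous_on linear_linear[THEN iffD2] matrix_vector_mul_linear)
  ultimately obtain w where w: "w \<in> ?C" and wmax: "\<And>x. x \<in> ?C \<Longrightarrow> ?f x \<le> ?f w"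
    using continuous_attains_sup[of ?C ?f] by blast
  define l where "l = ?f w"
  have n: "norm w = 1" and wS: "w \<in> S" using w by auto
  have bound: "?f x \<le> l * (norm x)\<^sup>2" if "x \<in> S" for x
  proof (cases "x = 0")
    case False
    then have "inverse (norm x) *\<^sub>R x \<in> ?C" using RS[OF that] by auto
    from wmax[OF this] have "inverse (norm x) * (inverse (norm x) * ?f x) \<le> l"
      by (simp only: l_def matrix_vector_scaleR inner_scaleR_left inner_scaleR_right)
    then have "(norm x)\<^sup>2 * (inverse (norm x) * (inverse (norm x) * ?f x)) \<le> (norm x)\<^sup>2 * l"
      by (intro mult_left_mono) auto
    also have "(norm x)\<^sup>2 * (inverse (norm x) * (inverse (norm x) * ?f x)) = ?f x"
      using False by (simp add: power2_eq_square field_simps)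
    finally show ?thesis by (simp add: mult.commute)
  qed simp
  \<comment> \<open>The maximality of \<open>w\<close> is tested along the residual \<open>z\<close>, which is orthogonal to \<open>w\<close>; the first-order
    term of the Rayleigh quotient is then \<open>\<parallel>z\<parallel>\<^sup>2\<close> itself.\<close>
  define z where "z = A *v w - l *\<^sub>R w"
  have zS: "z \<in> S" unfolding z_def using RS inv wS S by (auto intro: vec.subspace_diff)
  have wz: "w \<bullet> z = 0" using n by (simp add: z_def inner_diff_right l_def norm_eq_1)
  have zz: "z \<bullet> (A *v w) = (norm z)\<^sup>2"
  proof -
    have "A *v w = z + l *\<^sub>R w" by (simp add: z_def)
    then show ?thesis using wz by (simp add: inner_add_right power2_norm_eq_inner inner_commute)
  qed
  have wAz: "w \<bullet> (A *v z) = (norm z)\<^sup>2"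
    using zz inner_adjoint[of A w z] herm by (simp add: inner_commute)
  have "2 * t * (norm z)\<^sup>2 \<le> t\<^sup>2 * (l * (norm z)\<^sup>2 - ?f z)" for t
  proof -
    have "w + t *\<^sub>R z \<in> S" using wS zS RS S by (simp add: vec.subspace_add)
    from bound[OF this] have "?f (w + t *\<^sub>R z) \<le> l * (norm (w + t *\<^sub>R z))\<^sup>2" .
    moreover have "(norm (w + t *\<^sub>R z))\<^sup>2 = 1 + t\<^sup>2 * (norm z)\<^sup>2"
      unfolding power2_norm_eq_inner using wz n
      by (simp add: inner_add inner_commute power2_eq_square norm_eq_1 algebra_simps)
    moreover have "?f (w + t *\<^sub>R z) = l + 2 * t * (norm z)\<^sup>2 + t\<^sup>2 * ?f z"
      by (simp add: matrix_vector_right_distrib matrix_vector_scaleR inner_add zz wAz l_def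
          power2_eq_square algebra_simps)
    ultimately show ?thesis by (simp add: algebra_simps)
  qed
  then have "(norm z)\<^sup>2 = 0" by (rule quadratic_bound_imp_zero) simp
  then have "A *v w = of_real l *s w" by (simp add: z_def scaleR)
  with wS n bound show ?thesis by blast
qed

text \<open>
  Splitting off a maximiser of the Rayleigh quotient leaves an invariant subspace of one dimension
  less. Taking a maximum at each step makes the eigenvalues come out in decreasing order. With \<open>A = 0\<close>
  the theorem provides orthonormal bases of arbitrary subspaces.
\<close>
theorem spectral_theorem:
  fixes A :: "complex^'n^'n"
  assumes herm: "ctransp A = A" and S: "vec.subspace S" and inv: "\<And>x. x \<in> S \<Longrightarrow> A *v x \<in> S"
    and n: "vec.dim S = n"
  shows "\<exists>w l. (\<forall>i<n. w i \<in> S \<and> A *v w i = of_real (l i) *s w i) \<and> orthonormal_on {..<n} w \<and>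
           antimono_on {..<n} l \<and> (\<forall>x\<in>S. x = (\<Sum>i<n. cdot (w i) x *s w i))"
  using S inv n
proof (induction n arbitrary: S)
  case 0
  then have "S \<subseteq> {0}" by simp
  then show ?case by (auto simp: orthonormal_on_def monotone_on_def)
next
  case (Suc n)
  have "\<not> S \<subseteq> {0}" using Suc.prems(3) by (metis nat.distinct(1) vec.dim_eq_0)
  then obtain x0 where x0: "x0 \<in> S" "x0 \<noteq> 0" by auto
  obtain w0 l0 where w0: "w0 \<in> S" "norm w0 = 1" "A *v w0 = of_real l0 *s w0"
    and max: "\<And>x. x \<in> S \<Longrightarrow> x \<bullet> (A *v x) \<le> l0 * (norm x)\<^sup>2"
    using spectral_max[OF herm Suc.prems(1,2) x0] by blast
  have w00: "cdot w0 w0 = 1" using w0 by (simp add: cdot_self)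
  define T where "T = {x\<in>S. cdot w0 x = 0}"
  have T: "vec.subspace T"
    using Suc.prems(1) by (auto simp: T_def vec.subspace_def cdot_add_right cdot_smult_right)
  have Tinv: "A *v x \<in> T" if "x \<in> T" for x
  proof -
    have "cdot w0 (A *v x) = cdot (A *v w0) x" by (simp add: cdot_adjoint herm)
    also have "\<dots> = 0" using that by (simp add: w0(3) cdot_smult_left T_def)
    finally show ?thesis using that Suc.prems(2) by (simp add: T_def)
  qed
  have decomp: "x - cdot w0 x *s w0 \<in> T" if "x \<in> S" for x
    using that Suc.prems(1) w0(1) w00
    by (simp add: T_def cdot_diff_right cdot_smult_right vec.subspace_diff vec.subspace_scale)
  have "S = vec.span (insert w0 T)"
  proof
    show "S \<subseteq> vec.span (insert w0 T)"
    proof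
      fix x assume "x \<in> S"
      then have "x - cdot w0 x *s w0 \<in> vec.span T" using decomp by (simp add: vec.span_base)
      then show "x \<in> vec.span (insert w0 T)" by (auto simp: vec.span_insert)
    qed
    show "vec.span (insert w0 T) \<subseteq> S"
      using w0(1) Suc.prems(1) by (intro vec.span_minimal) (auto simp: T_def)
  qed
  moreover have "w0 \<notin> vec.span T"
    using T w00 by (simp add: vec.span_eq_iff[THEN iffD2]) (simp add: T_def)
  ultimately have "vec.dim S = vec.dim T + 1"
    by (simp add: vec.dim_insert)
  then have "vec.dim T = n" using Suc.prems(3) by simp
  from Suc.IH[OF T Tinv this] obtain w l where
    IH: "\<And>i. i < n \<Longrightarrow> w i \<in> T \<and> A *v w i = of_real (l i) *s w i" "orthonormal_on {..<n} w"
      "antimono_on {..<n} l" "\<And>x. x \<in> T \<Longrightarrow> x = (\<Sum>i<n. cdot (w i) x *s w i)" by blast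
  define w' where "w' = case_nat w0 w"
  define l' where "l' = case_nat l0 l"
  have 1: "w' i \<in> S \<and> A *v w' i = of_real (l' i) *s w' i" if "i < Suc n" for i
    using that w0 IH(1) by (cases i) (auto simp: w'_def l'_def T_def)
  have c0: "cdot w0 (w i) = 0" "cdot (w i) w0 = 0" if "i < n" for i
    using IH(1)[OF that] by (auto simp: T_def) (metis cnj_cdot complex_cnj_zero)
  have 2: "orthonormal_on {..<Suc n} w'"
    unfolding orthonormal_on_def
  proof (intro ballI)
    fix i j assume "i \<in> {..<Suc n}" "j \<in> {..<Suc n}"
    then show "cdot (w' i) (w' j) = (if i = j then 1 else 0)"
      using c0 w00 IH(2) by (cases i; cases j) (auto simp: w'_def orthonormal_on_def)
  qed
  have l_le: "l i \<le> l0" if "i < n" for i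
  proof -
    have "norm (w i) = 1" using IH(2) that by (simp add: orthonormal_on_norm)
    moreover have "w i \<bullet> (A *v w i) = l i * (norm (w i))\<^sup>2"
      using IH(1)[OF that] by (simp add: Re_cdot[symmetric] cdot_smult_right cdot_self)
    ultimately show ?thesis using max[of "w i"] IH(1)[OF that] by (simp add: T_def)
  qed
  have 3: "antimono_on {..<Suc n} l'"
  proof (rule monotone_onI)
    fix i j assume "i \<in> {..<Suc n}" "j \<in> {..<Suc n}" "i \<le> j"
    then show "l' j \<le> l' i"
      using l_le IH(3) by (cases i; cases j) (auto simp: l'_def monotone_on_def)
  qed
  have 4: "x = (\<Sum>i<Suc n. cdot (w' i) x *s w' i)" if "x \<in> S" for x
  proof -
    let ?y = "x - cdot w0 x *s w0"
    have "?y = (\<Sum>i<n. cdot (w i) ?y *s w i)" using IH(4) decomp[OF that] by blast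
    also have "\<dots> = (\<Sum>i<n. cdot (w i) x *s w i)"
      using c0 by (intro sum.cong) (auto simp: cdot_diff_right cdot_smult_right)
    finally have "x = cdot w0 x *s w0 + (\<Sum>i<n. cdot (w i) x *s w i)" by (simp add: algebra_simps)
    then show ?thesis by (simp add: sum.lessThan_Suc_shift w'_def del: sum.lessThan_Suc)
  qed
  show ?case using 1 2 3 4 by blast
qed

section \<open>Existence of a singular value decomposition\<close>

lemma sum_pos: "(\<Sum>i\<in>(UNIV :: 'n::{finite,linorder} set). f (pos i)) = (\<Sum>j=1..CARD('n). f j)"
  by (rule sum.reindex_bij_betw[OF bij_betw_pos])

lemma inj_pos: "pos i = pos j \<longleftrightarrow> i = j"
  using strict_mono_pos strict_mono_eq by blast

lemma pos_range: "1 \<le> pos (i :: 'n::{finite,linorder})" "pos (i :: 'n) \<le> CARD('n)"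
  using bij_betw_pos[where 'n = 'n] by (auto simp: bij_betw_def)

lemma diag_mat_mult_entry: "(diag_mat \<alpha> ** X) $ i $ j = of_real (\<alpha> (pos i)) * X $ i $ j"
  by (simp add: matrix_matrix_mult_def diag_mat_def if_distrib[of "\<lambda>z. z * _"] cong: if_cong)

lemma mult_diag_mat_entry: "(X ** diag_mat \<alpha>) $ i $ j = X $ i $ j * of_real (\<alpha> (pos j))"
  by (simp add: matrix_matrix_mult_def diag_mat_def if_distrib[of "\<lambda>z. _ * z"] cong: if_cong)

lemma column_mult_diag_mat: "column j (X ** diag_mat \<alpha>) = of_real (\<alpha> (pos j)) *s column j X"
  by (simp add: vec_eq_iff column_def mult_diag_mat_entry mult.commute)

lemma diag_mat_mult_vec: "(diag_mat \<alpha> *v x) $ i = of_real (\<alpha> (pos i)) * x $ i"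
  by (simp add: diag_mat_def matrix_vector_mult_def if_distrib[of "\<lambda>z. z * _"] cong: if_cong)

lemma ctransp_mult_vec: "(ctransp V *v x) $ i = cdot (column i V) x"
  by (simp add: ctransp_def matrix_vector_mult_def cdot_def column_def)

lemma factored_mult_vec:
  "(U ** diag_mat \<alpha> ** ctransp V) *v x =
     (\<Sum>i\<in>UNIV. (of_real (\<alpha> (pos i)) * cdot (column i V) x) *s column i U)"
  by (simp add: matrix_vector_mul_assoc[symmetric] matrix_mult_sum[of U] diag_mat_mult_vec
      ctransp_mult_vec)

text \<open>
  A decreasing sequence is determined by the sizes of its level sets: \<open>a j > t\<close> means that at least
  \<open>j\<close> indices satisfy \<open>a i > t\<close>. Nonnegativity makes the positive levels sufficient.
\<close>
lemma antimono_levels_le: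
  fixes a b :: "nat \<Rightarrow> real"
  assumes a: "antimono_on {1..n} a" "\<And>j. j \<in> {1..n} \<Longrightarrow> 0 \<le> a j"
    and b: "antimono_on {1..n} b" "\<And>j. j \<in> {1..n} \<Longrightarrow> 0 \<le> b j"
    and levels: "\<And>s. s > 0 \<Longrightarrow> card {j\<in>{1..n}. a j = s} = card {j\<in>{1..n}. b j = s}"
    and j: "j \<in> {1..n}"
  shows "a j \<le> b j"
proof (rule ccontr)
  assume "\<not> a j \<le> b j"
  then have less: "b j < a j" by simp
  let ?S = "{s \<in> a ` {1..n} \<union> b ` {1..n}. s > b j}"
  have pos: "s > 0" if "s \<in> ?S" for s using that b(2)[OF j] by auto
  have count: "card {i\<in>{1..n}. c i > b j} = (\<Sum>s\<in>?S. card {i\<in>{1..n}. c i = s})"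
    if "c ` {1..n} \<subseteq> a ` {1..n} \<union> b ` {1..n}" for c
  proof -
    have "{i\<in>{1..n}. c i > b j} = (\<Union>s\<in>?S. {i\<in>{1..n}. c i = s})" using that by (auto simp del: atLeastAtMost_iff)
    then show ?thesis by (simp only:) (subst card_UN_disjoint, auto)
  qed
  have "card {i\<in>{1..n}. a i > b j} = card {i\<in>{1..n}. b i > b j}"
    by (simp only: count[of a, OF Un_upper1] count[of b, OF Un_upper2] levels[OF pos] cong: sum.cong)
  moreover have "card {1..j} \<le> card {i\<in>{1..n}. a i > b j}"
  proof (intro card_mono subsetI)
    fix i assume "i \<in> {1..j}"
    then have "a j \<le> a i" "i \<in> {1..n}" using a(1) j by (auto simp: monotone_on_def)
    then show "i \<in> {i\<in>{1..n}. a i > b j}" using less by simp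
  qed simp
  moreover have "card {i\<in>{1..n}. b i > b j} \<le> card {1..<j}"
  proof (intro card_mono subsetI)
    fix i assume i: "i \<in> {i\<in>{1..n}. b i > b j}"
    then have "\<not> j \<le> i" using monotone_onD[OF b(1) j, of i] by auto
    then show "i \<in> {1..<j}" using i by simp
  qed simp
  ultimately have "card {1..j} \<le> card {1..<j}" by linarith
  then show False using j by (cases j) auto
qed

text \<open>
  The \<open>v i\<close> diagonalise \<open>F\<^sup>* F\<close>; the images \<open>F v i\<close> are orthogonal, and those that do not vanish give the
  first left singular vectors after normalisation. The definition of singular values prescribes the
  dimensions of the eigenspaces only, so the square roots of the eigenvalues have to be identified with
  \<open>\<phi>\<close> by comparing level sets.
\<close>
theorem svd_exists:
  fixes F :: "complex^'q^'p"
  assumes \<phi>: "singular_values F \<phi>" and card_n: "CARD('n::{finite,linorder}) = min CARD('p) CARD('q)"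
  shows "\<exists>(U :: complex^('n::{finite,linorder})^'p) (V :: complex^('n::{finite,linorder})^'q). is_svd F U \<phi> V"
proof -
  let ?N = "min CARD('p) CARD('q)" and ?A = "ctransp F ** F"
  have herm: "ctransp ?A = ?A" by (simp add: ctransp_mult)
  obtain v l where v: "\<And>i. i < CARD('q) \<Longrightarrow> ?A *v v i = of_real (l i) *s v i"
    and on: "orthonormal_on {..<CARD('q)} v" and l: "antimono_on {..<CARD('q)} l"
    and complete: "\<And>x. x = (\<Sum>i<CARD('q). cdot (v i) x *s v i)"
    using spectral_theorem[OF herm vec.subspace_UNIV, of "CARD('q)"] vec_dim_card[where 'a = complex and 'n = 'q]
    by auto
  have gram: "cdot (F *v v i) (F *v v j) = (if i = j then of_real (l j) else 0)"
    if "i < CARD('q)" "j < CARD('q)" for i j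
  proof -
    have "cdot (F *v v i) (F *v v j) = cdot (v i) (?A *v v j)"
      by (simp add: cdot_adjoint matrix_vector_mul_assoc)
    then show ?thesis using on that by (simp add: v cdot_smult_right orthonormal_on_def)
  qed
  have l_norm: "l i = (norm (F *v v i))\<^sup>2" if "i < CARD('q)" for i
    using gram[OF that that] unfolding cdot_self by (simp only: refl if_True of_real_eq_iff)
  define \<sigma> where "\<sigma> i = sqrt (l i)" for i
  have l0: "l i \<ge> 0" if "i < CARD('q)" for i using l_norm[OF that] by simp
  have \<sigma>2: "(\<sigma> i)\<^sup>2 = l i" if "i < CARD('q)" for i using l0[OF that] by (simp add: \<sigma>_def)
  \<comment> \<open>As \<open>l\<close> decreases, the indices of the positive eigenvalues are exactly those below \<open>r\<close>.\<close>
  define r where "r = card {i. i < CARD('q) \<and> l i > 0}"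
  have pos_iff: "l i > 0 \<longleftrightarrow> i < r" if "i < CARD('q)" for i
  proof
    assume "l i > 0"
    then have "{..i} \<subseteq> {i. i < CARD('q) \<and> l i > 0}"
      using l that by (auto simp: monotone_on_def intro: less_le_trans)
    then have "card {..i} \<le> r" unfolding r_def by (intro card_mono) auto
    then show "i < r" by simp
  next
    assume i: "i < r"
    show "l i > 0"
    proof (rule ccontr)
      assume n: "\<not> l i > 0"
      have "{i. i < CARD('q) \<and> l i > 0} \<subseteq> {..<i}"
      proof
        fix k assume k: "k \<in> {i. i < CARD('q) \<and> l i > 0}"
        show "k \<in> {..<i}"
        proof (rule ccontr)
          assume "k \<notin> {..<i}"
          then have "l k \<le> l i" using l k that by (auto simp: monotone_on_def)
          then show False using n k by simp
        qed
      qed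
      then have "r \<le> card {..<i}" unfolding r_def by (intro card_mono) auto
      then show False using i by simp
    qed
  qed
  have rq: "r \<le> CARD('q)" unfolding r_def by (rule order.trans[OF card_mono[of "{..<CARD('q)}"]]) auto
  define u0 where "u0 i = of_real (inverse (\<sigma> i)) *s (F *v v i)" for i
  have u0: "orthonormal_on {..<r} u0"
    unfolding orthonormal_on_def
  proof (intro ballI)
    fix i j assume ij: "i \<in> {..<r}" "j \<in> {..<r}"
    then have ij': "i < CARD('q)" "j < CARD('q)" using rq by auto
    have lj: "l j > 0" using pos_iff ij ij' by auto
    have "cdot (u0 i) (u0 j) = of_real (inverse (\<sigma> i) * inverse (\<sigma> j)) * (if i = j then of_real (l j) else 0)"
      by (simp add: u0_def cdot_smult_left cdot_smult_right gram ij')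
    also have "\<dots> = (if i = j then of_real (inverse (\<sigma> j) * inverse (\<sigma> j) * l j) else 0)"
      by (simp only: of_real_mult) simp
    also have "inverse (\<sigma> j) * inverse (\<sigma> j) * l j = 1"
      using lj \<sigma>2[OF ij'(2), symmetric] by (auto simp: power2_eq_square field_simps)
    finally show "cdot (u0 i) (u0 j) = (if i = j then 1 else 0)" by simp
  qed
  then have "r \<le> CARD('p)" using orthonormal_card_le[OF u0] by simp
  then have rN: "r \<le> ?N" using rq by simp
  obtain u where u: "orthonormal_on {..<?N} u" "\<And>i. i < r \<Longrightarrow> u i = u0 i"
    using orthonormal_extend[OF u0 rN] by auto
  have Fv: "F *v v i = (if i < ?N then of_real (\<sigma> i) *s u i else 0)" if "i < CARD('q)" for i
  proof (cases "i < r")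
    case True
    then have "\<sigma> i \<noteq> 0" using pos_iff[OF that] by (simp add: \<sigma>_def)
    then have "of_real (\<sigma> i) * of_real (inverse (\<sigma> i)) = (1 :: complex)"
      by (simp only: of_real_mult[symmetric]) simp
    then show ?thesis using True rN by (simp add: u(2) u0_def vector_smult_assoc)
  next
    case False
    then have "l i = 0" using pos_iff[OF that] l0[OF that] by simp
    then show ?thesis using l_norm[OF that] by (simp add: \<sigma>_def)
  qed
  \<comment> \<open>The spectral theorem counts from \<open>0\<close>, singular values from \<open>1\<close>.\<close>
  define b where "b j = \<sigma> (j - 1)" for j
  have b_anti: "antimono_on {1..?N} b"
    using l by (auto simp: monotone_on_def b_def \<sigma>_def)
  have b_nn: "0 \<le> b j" if "j \<in> {1..?N}" for j
  proof -
    have "j - 1 < CARD('q)" using that by auto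
    then show ?thesis using l0 by (simp add: b_def \<sigma>_def)
  qed
  have levels: "card {j\<in>{1..?N}. \<phi> j = s} = card {j\<in>{1..?N}. b j = s}" if s: "s > 0" for s
  proof -
    let ?I = "{i. i < CARD('q) \<and> l i = s\<^sup>2}"
    have "{x. ?A *v x = of_real (s\<^sup>2) *s x} = vec.span (v ` ?I)"
    proof
      have "?A *v v i = of_real (s\<^sup>2) *s v i" if "i \<in> ?I" for i using v that by simp
      moreover have "vec.subspace {x. ?A *v x = of_real (s\<^sup>2) *s x}"
        by (auto simp: vec.subspace_def matrix_vector_right_distrib matrix_vector_mult_smult
            vector_add_ldistrib vector_smult_assoc mult.commute)
      ultimately show "vec.span (v ` ?I) \<subseteq> {x. ?A *v x = of_real (s\<^sup>2) *s x}"
        by (intro vec.span_minimal) auto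
    next
      show "{x. ?A *v x = of_real (s\<^sup>2) *s x} \<subseteq> vec.span (v ` ?I)"
      proof
        fix x assume "x \<in> {x. ?A *v x = of_real (s\<^sup>2) *s x}"
        then have x: "?A *v x = of_real (s\<^sup>2) *s x" by simp
        have "cdot (v i) x *s v i \<in> vec.span (v ` ?I)" if i: "i < CARD('q)" for i
        proof (cases "i \<in> ?I")
          case True
          then show ?thesis by (intro vec.span_scale vec.span_base) auto
        next
          case False
          have "of_real (l i) * cdot (v i) x = cdot (?A *v v i) x"
            using i by (simp add: v cdot_smult_left)
          also have "\<dots> = of_real (s\<^sup>2) * cdot (v i) x"
            unfolding cdot_adjoint herm x cdot_smult_right ..
          finally have "cdot (v i) x = 0" using False i by (simp del: of_real_power)
          then show ?thesis by (simp add: vec.span_zero)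
        qed
        then have "(\<Sum>i<CARD('q). cdot (v i) x *s v i) \<in> vec.span (v ` ?I)"
          by (intro vec.span_sum) auto
        then show "x \<in> vec.span (v ` ?I)" using complete[of x] by simp
      qed
    qed
    moreover have "orthonormal_on ?I v" using on by (auto simp: orthonormal_on_def)
    ultimately have "vec.dim {x. ?A *v x = of_real (s\<^sup>2) *s x} = card ?I"
      using dim_span_orthonormal[of ?I v] by simp
    moreover have "?I = (\<lambda>j. j - 1) ` {j\<in>{1..?N}. b j = s}"
    proof (intro set_eqI iffI)
      fix i assume i: "i \<in> ?I"
      then have "i < r" using pos_iff[of i] s zero_less_power[OF s, of 2] by simp
      then have "Suc i \<in> {j\<in>{1..?N}. b j = s}" using rN i s by (auto simp: b_def \<sigma>_def)
      then show "i \<in> (\<lambda>j. j - 1) ` {j\<in>{1..?N}. b j = s}" by force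
    next
      fix i assume "i \<in> (\<lambda>j. j - 1) ` {j\<in>{1..?N}. b j = s}"
      then obtain j where j: "j \<in> {1..?N}" "b j = s" "i = j - 1" by auto
      then show "i \<in> ?I" using \<sigma>2[of i] by (auto simp: b_def)
    qed
    moreover have "inj_on (\<lambda>j. j - 1) {j\<in>{1..?N}. b j = s}" by (auto simp: inj_on_def)
    ultimately have "vec.dim {x. ?A *v x = of_real (s\<^sup>2) *s x} = card {j\<in>{1..?N}. b j = s}"
      by (simp add: card_image)
    then show ?thesis using \<phi> s by (simp add: singular_values_def Let_def)
  qed
  have \<phi>_anti: "antimono_on {1..?N} \<phi>" and \<phi>_nn: "\<And>j. j \<in> {1..?N} \<Longrightarrow> 0 \<le> \<phi> j"
    using \<phi> by (simp_all add: singular_values_def Let_def)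
  have \<phi>_eq: "\<phi> j = b j" if "j \<in> {1..?N}" for j
    using antimono_levels_le[OF \<phi>_anti \<phi>_nn b_anti b_nn levels that]
      antimono_levels_le[OF b_anti b_nn \<phi>_anti \<phi>_nn levels[symmetric] that] by linarith
  define U :: "complex^('n::{finite,linorder})^'p" where "U = (\<chi> i j. u (pos j - 1) $ i)"
  define V :: "complex^('n::{finite,linorder})^'q" where "V = (\<chi> i j. v (pos j - 1) $ i)"
  have colU: "column j U = u (pos j - 1)" and colV: "column j V = v (pos j - 1)" for j
    by (simp_all add: U_def V_def column_def vec_eq_iff)
  have idx: "pos j - 1 < ?N" "pos j - 1 < CARD('q)" "pos j \<in> {1..?N}" for j :: 'n
    using pos_range[of j] card_n by auto
  have idx_eq: "pos i - 1 = pos j - 1 \<longleftrightarrow> i = j" for i j :: 'n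
    using pos_range(1)[of i] pos_range(1)[of j] inj_pos[of i j] by linarith
  have "ctransp U ** U = mat 1" "ctransp V ** V = mat 1"
    unfolding isometry_iff_columns colU colV
    using u(1) on idx(1,2) by (simp_all add: orthonormal_on_def idx_eq del: One_nat_def)
  moreover have "F = U ** diag_mat \<phi> ** ctransp V"
    unfolding matrix_eq
  proof
    fix x
    have "F *v x = F *v (\<Sum>i<CARD('q). cdot (v i) x *s v i)" using complete[of x] by simp
    also have "\<dots> = (\<Sum>i<CARD('q). cdot (v i) x *s (F *v v i))"
      by (simp add: vec.linear_sum[OF matrix_vector_mul_linear_gen] matrix_vector_mult_smult)
    also have "\<dots> = (\<Sum>i<?N. (of_real (\<sigma> i) * cdot (v i) x) *s u i)"
      by (rule sum.mono_neutral_cong_right) (auto simp: Fv vector_smult_assoc mult.commute)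
    also have "\<dots> = (\<Sum>j=1..?N. (of_real (\<phi> j) * cdot (v (j - 1)) x) *s u (j - 1))"
      by (rule sum.reindex_bij_witness[of _ "\<lambda>j. j - 1" Suc]) (auto simp: \<phi>_eq b_def)
    also have "\<dots> = (U ** diag_mat \<phi> ** ctransp V) *v x"
      unfolding factored_mult_vec colU colV sum_pos[of "\<lambda>j. (of_real (\<phi> j) * cdot (v (j - 1)) x) *s u (j - 1)"]
      by (simp add: card_n)
    finally show "F *v x = (U ** diag_mat \<phi> ** ctransp V) *v x" .
  qed
  ultimately have "is_svd F U \<phi> V" using \<phi> card_n by (simp add: is_svd_def)
  then show ?thesis by blast
qed

section \<open>Rank\<close>

lemma row_matrix_mult: "row k (C ** A) = (\<Sum>i\<in>UNIV. C $ k $ i *s row i A)"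
  by (simp add: vec_eq_iff row_def matrix_matrix_mult_def)

text \<open>
  The row space is spanned by the conjugates of those columns of \<open>V\<close> whose coefficient does not
  vanish; multiplication by \<open>U\<^sup>*\<close> recovers them from the rows.
\<close>
lemma rank_factored:
  fixes U :: "complex^('n::{finite,linorder})^'p" and V :: "complex^('n::{finite,linorder})^'q"
  assumes U: "ctransp U ** U = mat 1" and V: "ctransp V ** V = mat 1"
  shows "rank (U ** diag_mat \<alpha> ** ctransp V) = card {j\<in>{1..CARD('n)}. \<alpha> j \<noteq> 0}"
proof -
  let ?A = "U ** diag_mat \<alpha> ** ctransp V" and ?I = "{i :: 'n. \<alpha> (pos i) \<noteq> 0}"
  define w where "w i = row i (ctransp V)" for i
  have w: "orthonormal_on ?I w"
  proof -
    have "cdot (w i) (w j) = cdot (column j V) (column i V)" for i j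
      by (simp add: w_def cdot_def row_def column_def ctransp_def mult.commute)
    then show ?thesis using V by (simp add: isometry_iff_columns orthonormal_on_def)
  qed
  have rowA: "row i ?A = (\<Sum>j\<in>UNIV. (U $ i $ j * of_real (\<alpha> (pos j))) *s w j)" for i
    by (simp add: vec_eq_iff row_def w_def matrix_matrix_mult_def diag_mat_def
        if_distrib[of "\<lambda>z. _ * z"] cong: if_cong)
  have "rows ?A \<subseteq> vec.span (w ` ?I)"
  proof
    fix x assume "x \<in> rows ?A"
    then obtain i where x: "x = row i ?A" by (auto simp: rows_def)
    have "(U $ i $ j * of_real (\<alpha> (pos j))) *s w j \<in> vec.span (w ` ?I)" for j
    proof (cases "j \<in> ?I")
      case True
      then show ?thesis by (intro vec.span_scale vec.span_base) simp
    qed (simp add: vec.span_zero)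
    then show "x \<in> vec.span (w ` ?I)" unfolding x rowA by (intro vec.span_sum) auto
  qed
  moreover have "w ` ?I \<subseteq> vec.span (rows ?A)"
  proof
    fix x assume "x \<in> w ` ?I"
    then obtain k where k: "\<alpha> (pos k) \<noteq> 0" "x = w k" by auto
    have "diag_mat \<alpha> ** ctransp V = ctransp U ** ?A"
      by (simp add: matrix_mul_assoc U)
    then have "row k (diag_mat \<alpha> ** ctransp V) = row k (ctransp U ** ?A)" by simp
    also have "\<dots> = (\<Sum>i\<in>UNIV. cnj (U $ i $ k) *s row i ?A)"
      unfolding row_matrix_mult by (simp add: ctransp_def)
    also have "row k (diag_mat \<alpha> ** ctransp V) = of_real (\<alpha> (pos k)) *s w k"
      by (simp add: vec_eq_iff row_def w_def matrix_matrix_mult_def diag_mat_def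
          if_distrib[of "\<lambda>z. z * _"] cong: if_cong)
    finally have *: "of_real (\<alpha> (pos k)) *s w k = (\<Sum>i\<in>UNIV. cnj (U $ i $ k) *s row i ?A)" .
    have "x = of_real (inverse (\<alpha> (pos k))) *s (of_real (\<alpha> (pos k)) *s w k)"
      using k by (simp add: vector_smult_assoc)
    also have "\<dots> \<in> vec.span (rows ?A)"
      unfolding * by (intro vec.span_scale vec.span_sum vec.span_base) (auto simp: rows_def)
    finally show "x \<in> vec.span (rows ?A)" .
  qed
  ultimately have "vec.span (rows ?A) = vec.span (w ` ?I)"
    by (metis subset_antisym vec.span_minimal vec.subspace_span)
  then have "rank ?A = card ?I"
    unfolding row_rank_def_gen using dim_span_orthonormal[OF w] by (metis finite vec.dim_span)
  also have "\<dots> = card (pos ` ?I)"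
    using strict_mono_pos strict_mono_imp_inj_on by (metis card_image inj_on_subset subset_UNIV)
  also have "pos ` ?I = {j\<in>{1..CARD('n)}. \<alpha> j \<noteq> 0}"
    using bij_betw_pos[where 'n = 'n] by (auto simp: bij_betw_def)
  finally show ?thesis .
qed

section \<open>Relaxed projections\<close>

text \<open>
  The convex relaxation of the orthogonal projections of rank at most \<open>K\<close>. For Hermitian \<open>Q\<close> the
  quadratic condition says \<open>Q\<^sup>2 \<le> Q\<close>, that is \<open>0 \<le> Q \<le> 1\<close>; in this form it bounds \<open>Q\<close> and gives
  the equality cases in \<open>relaxed_projections_unit\<close> at once.
\<close>
definition relaxed_projections :: "nat \<Rightarrow> (complex^'n^'n) set" where
  "relaxed_projections K =
     {Q. ctransp Q = Q \<and> (\<forall>x. (norm (Q *v x))\<^sup>2 \<le> x \<bullet> (Q *v x)) \<and> Re (trace Q) \<le> real K}"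

lemma relaxed_projectionsD:
  assumes "Q \<in> relaxed_projections K"
  shows "ctransp Q = Q" "(norm (Q *v x))\<^sup>2 \<le> x \<bullet> (Q *v x)" "Re (trace Q) \<le> real K"
  using assms by (auto simp: relaxed_projections_def)

lemma norm_square_convex:
  fixes a b :: "'a::real_inner"
  assumes "0 \<le> t" "t \<le> 1"
  shows "(norm ((1 - t) *\<^sub>R a + t *\<^sub>R b))\<^sup>2 \<le> (1 - t) * (norm a)\<^sup>2 + t * (norm b)\<^sup>2"
proof -
  have "(1 - t) * (norm a)\<^sup>2 + t * (norm b)\<^sup>2 - (norm ((1 - t) *\<^sub>R a + t *\<^sub>R b))\<^sup>2
      = t * (1 - t) * (norm (a - b))\<^sup>2"
    unfolding power2_norm_eq_inner
    by (simp add: inner_add inner_diff inner_commute algebra_simps power2_eq_square)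
  moreover have "0 \<le> t * (1 - t) * (norm (a - b))\<^sup>2" using assms by simp
  ultimately show ?thesis by linarith
qed

lemma matrix_vector_scaleR_left: "(r *\<^sub>R A) *v x = r *\<^sub>R (A *v (x :: complex^'n))"
  by (simp add: vec_eq_iff matrix_vector_mult_def scaleR_sum_right)

lemma relaxed_projections_convex:
  assumes P: "P \<in> relaxed_projections K" and Q: "Q \<in> relaxed_projections K" and t: "0 \<le> t" "t \<le> 1"
  shows "(1 - t) *\<^sub>R P + t *\<^sub>R Q \<in> relaxed_projections K"
proof -
  have "(norm (((1 - t) *\<^sub>R P + t *\<^sub>R Q) *v x))\<^sup>2 \<le> x \<bullet> (((1 - t) *\<^sub>R P + t *\<^sub>R Q) *v x)" for x
  proof -
    have "(norm (((1 - t) *\<^sub>R P + t *\<^sub>R Q) *v x))\<^sup>2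
        \<le> (1 - t) * (norm (P *v x))\<^sup>2 + t * (norm (Q *v x))\<^sup>2"
      using norm_square_convex[OF t, of "P *v x" "Q *v x"]
      by (simp add: matrix_vector_mult_add_rdistrib matrix_vector_scaleR_left)
    also have "\<dots> \<le> (1 - t) * (x \<bullet> (P *v x)) + t * (x \<bullet> (Q *v x))"
      using t relaxed_projectionsD(2)[OF P, of x] relaxed_projectionsD(2)[OF Q, of x]
      by (intro add_mono mult_left_mono) auto
    finally show ?thesis
      by (simp add: matrix_vector_mult_add_rdistrib matrix_vector_scaleR_left inner_add_right)
  qed
  moreover have "(1 - t) * Re (trace P) + t * Re (trace Q) \<le> (1 - t) * real K + t * real K"
    using t relaxed_projectionsD(3)[OF P] relaxed_projectionsD(3)[OF Q]
    by (intro add_mono mult_left_mono) auto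
  then have "Re (trace ((1 - t) *\<^sub>R P + t *\<^sub>R Q)) \<le> real K"
    by (simp only: trace_add trace_scaleR) (simp add: algebra_simps)
  ultimately show ?thesis
    using relaxed_projectionsD(1)[OF P] relaxed_projectionsD(1)[OF Q]
    by (simp add: relaxed_projections_def ctransp_add ctransp_scaleR)
qed

lemma relaxed_projection_contraction:
  assumes "Q \<in> relaxed_projections K"
  shows "norm (Q *v x) \<le> norm x"
proof -
  have "(norm (Q *v x))\<^sup>2 \<le> norm x * norm (Q *v x)"
    using relaxed_projectionsD(2)[OF assms, of x] norm_cauchy_schwarz[of x "Q *v x"] by linarith
  then show ?thesis
    by (cases "norm (Q *v x) = 0") (auto simp: power2_eq_square)
qed

lemma mult_axis: "A *v axis j 1 = column j (A :: complex^'n^'m)"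
  by (simp add: vec_eq_iff matrix_vector_mult_def axis_def column_def
      if_distrib[of "\<lambda>z. _ * z"] cong: if_cong)

lemma norm_axis_complex: "norm (axis i 1 :: complex^'n) = 1"
  using orthonormal_on_norm[of UNIV "\<lambda>i :: 'n. axis i 1" i]
  by (simp add: orthonormal_on_def cdot_axis_axis)

lemma relaxed_projections_compact: "compact (relaxed_projections K :: (complex^'n^'n) set)"
  unfolding compact_eq_bounded_closed
proof
  have "norm Q \<le> sqrt CARD('n)" if Q: "Q \<in> relaxed_projections K" for Q :: "complex^'n^'n"
  proof -
    have "norm (column j Q) \<le> 1" for j
      using relaxed_projection_contraction[OF Q, of "axis j 1"]
      by (simp add: mult_axis norm_axis_complex)
    then have "(norm (column j Q))\<^sup>2 \<le> 1" for j by (simp add: power_le_one)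
    then have "Q \<bullet> Q \<le> (\<Sum>j\<in>(UNIV :: 'n set). 1)"
      unfolding inner_matrix_columns power2_norm_eq_inner[symmetric] by (intro sum_mono)
    then show ?thesis by (simp add: norm_eq_sqrt_inner)
  qed
  then show "bounded (relaxed_projections K :: (complex^'n^'n) set)"
    unfolding bounded_iff by blast
next
  have 1: "continuous_on UNIV (\<lambda>Q :: complex^'n^'n. ctransp Q)"
    unfolding ctransp_def by (intro continuous_intros)
  have 2: "continuous_on UNIV (\<lambda>Q :: complex^'n^'n. Q *v x)" for x
    unfolding matrix_vector_mult_def by (intro continuous_intros)
  have 3: "continuous_on UNIV (\<lambda>Q :: complex^'n^'n. trace Q)"
    unfolding trace_def by (intro continuous_intros)
  show "closed (relaxed_projections K :: (complex^'n^'n) set)"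
    unfolding relaxed_projections_def
    by (intro closed_Collect_conj closed_Collect_all closed_Collect_eq closed_Collect_le
        continuous_intros 1 2 3)
qed

text \<open>
  Both equality cases come from \<open>\<parallel>Q x\<parallel>\<^sup>2 \<le> \<langle>x, Q x\<rangle>\<close>: for the value \<open>1\<close> expand
  \<open>\<parallel>Q x - x\<parallel>\<^sup>2\<close>.
\<close>
lemma relaxed_projections_unit:
  assumes Q: "Q \<in> relaxed_projections K" and x: "norm x = 1"
  shows "0 \<le> x \<bullet> (Q *v x)" "x \<bullet> (Q *v x) \<le> 1"
    and "x \<bullet> (Q *v x) = 1 \<Longrightarrow> Q *v x = x" "x \<bullet> (Q *v x) = 0 \<Longrightarrow> Q *v x = 0"
proof -
  note le = relaxed_projectionsD(2)[OF Q, of x]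
  show "0 \<le> x \<bullet> (Q *v x)" using le zero_le_power2[of "norm (Q *v x)"] by linarith
  show "x \<bullet> (Q *v x) \<le> 1"
    using norm_cauchy_schwarz[of x "Q *v x"] relaxed_projection_contraction[OF Q, of x] x by simp
  show "Q *v x = 0" if "x \<bullet> (Q *v x) = 0" using le that by simp
  show "Q *v x = x" if one: "x \<bullet> (Q *v x) = 1"
  proof -
    have "(norm (Q *v x - x))\<^sup>2 = (norm (Q *v x))\<^sup>2 - 2 * (x \<bullet> (Q *v x)) + (norm x)\<^sup>2"
      unfolding power2_norm_eq_inner by (simp add: inner_diff inner_commute)
    then have "(norm (Q *v x - x))\<^sup>2 \<le> 0" using le one x by simp
    then show ?thesis by simp
  qed
qed

lemma relaxed_projection_matrix:
  assumes "Q \<in> relaxed_projections K"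
  shows "(norm (Q ** X))\<^sup>2 \<le> X \<bullet> (Q ** X)"
  unfolding power2_norm_eq_inner inner_matrix_columns column_matrix_mult
  by (intro sum_mono) (simp add: power2_norm_eq_inner[symmetric] relaxed_projectionsD[OF assms])

text \<open>
  With the complementary projection \<open>R = 1 - V V\<^sup>*\<close> the right-hand side is the trace of \<open>R Q R\<close>,
  which dominates \<open>\<parallel>Q R\<parallel>\<^sup>2\<close>. Thus a compression that keeps the whole trace of \<open>Q\<close> loses nothing of \<open>Q\<close>.
\<close>
lemma compression_trace:
  assumes Q: "Q \<in> relaxed_projections K" and V: "ctransp V ** V = mat 1"
  shows "(norm (Q - Q ** V ** ctransp V))\<^sup>2 \<le> Re (trace Q) - Re (trace (ctransp V ** Q ** V))"
proof -
  let ?P = "V ** ctransp V"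
  let ?R = "mat 1 - ?P"
  have PP: "?P ** ?P = ?P" by (metis V matrix_mul_assoc matrix_mul_lid)
  have R: "ctransp ?R = ?R" "?R ** ?R = ?R"
    by (simp_all add: ctransp_diff ctransp_mult matrix_diff_ldistrib matrix_diff_rdistrib PP)
  have "Q - Q ** V ** ctransp V = Q ** ?R"
    by (simp add: matrix_diff_ldistrib matrix_mul_assoc)
  then have "(norm (Q - Q ** V ** ctransp V))\<^sup>2 \<le> ?R \<bullet> (Q ** ?R)"
    using relaxed_projection_matrix[OF Q, of ?R] by simp
  also have "\<dots> = Re (trace (?R ** (Q ** ?R)))"
    by (simp add: inner_matrix_trace R)
  also have "trace (?R ** (Q ** ?R)) = trace ((Q ** ?R) ** ?R)" by (rule trace_mul_sym)
  also have "(Q ** ?R) ** ?R = Q - (Q ** V) ** ctransp V"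
    by (metis R(2) matrix_mul_assoc \<open>Q - Q ** V ** ctransp V = Q ** ?R\<close>)
  also have "trace (Q - (Q ** V) ** ctransp V) = trace Q - trace (ctransp V ** (Q ** V))"
    by (simp only: trace_diff trace_mul_sym[of "Q ** V"])
  finally show ?thesis by (simp add: matrix_mul_assoc)
qed

lemma compression_relaxed:
  assumes Q: "Q \<in> relaxed_projections K" and V: "ctransp V ** V = mat 1"
  shows "ctransp V ** Q ** V \<in> relaxed_projections K"
proof -
  have "(norm ((ctransp V ** Q ** V) *v x))\<^sup>2 \<le> x \<bullet> ((ctransp V ** Q ** V) *v x)" for x
  proof -
    have "(norm (ctransp V *v (Q *v (V *v x))))\<^sup>2 \<le> (norm (Q *v (V *v x)))\<^sup>2"
      by (intro power_mono coisometry_norm_le V) simp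
    also have "\<dots> \<le> (V *v x) \<bullet> (Q *v (V *v x))" by (rule relaxed_projectionsD(2)[OF Q])
    also have "\<dots> = x \<bullet> (ctransp V *v (Q *v (V *v x)))" by (rule inner_adjoint)
    finally show ?thesis by (simp add: matrix_vector_mul_assoc matrix_mul_assoc)
  qed
  moreover have "Re (trace (ctransp V ** Q ** V)) \<le> real K"
    using compression_trace[OF Q V] relaxed_projectionsD(3)[OF Q]
      zero_le_power2[of "norm (Q - Q ** V ** ctransp V)"] by linarith
  ultimately show ?thesis
    using relaxed_projectionsD(1)[OF Q] by (simp add: relaxed_projections_def ctransp_mult matrix_mul_assoc)
qed

text \<open>
  Take the orthogonal projection onto the span of the conjugated rows of \<open>B\<close>. The rank is by
  definition the dimension of the span of the rows, so an orthonormal basis of that span has the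
  right size.
\<close>
lemma rank_le_projection:
  fixes B :: "complex^'q^'p"
  assumes "rank B \<le> K"
  shows "\<exists>Q\<in>relaxed_projections K. Q ** Q = Q \<and> B ** Q = B"
proof -
  let ?S = "vec.span (rows B)"
  define r where "r = vec.dim ?S"
  have r: "r \<le> K" using assms by (simp add: r_def row_rank_def_gen)
  have "ctransp (0 :: complex^'q^'q) = 0" by (simp add: ctransp_def vec_eq_iff)
  from spectral_theorem[OF this vec.subspace_span, of "rows B" r] obtain w :: "nat \<Rightarrow> complex^'q"
    where w: "\<And>i. i < r \<Longrightarrow> w i \<in> ?S" "orthonormal_on {..<r} w"
      and complete: "\<And>x. x \<in> ?S \<Longrightarrow> x = (\<Sum>i<r. cdot (w i) x *s w i)"
    by (auto simp: vec.span_zero r_def)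
  \<comment> \<open>Multiplication from the right acts on the rows of \<open>B\<close>, hence the conjugation: \<open>Q\<close> projects onto the
    span of the conjugated \<open>w k\<close>.\<close>
  define Q :: "complex^'q^'q" where "Q = (\<chi> i j. \<Sum>k<r. cnj (w k $ i) * w k $ j)"
  have absorb: "C ** Q = C" if "\<And>i. row i C \<in> ?S" for C :: "complex^'q^'k"
  proof -
    have "(C ** Q) $ i $ j = C $ i $ j" for i j
    proof -
      have "(C ** Q) $ i $ j = (\<Sum>l\<in>UNIV. \<Sum>k<r. C $ i $ l * (cnj (w k $ l) * w k $ j))"
        by (simp add: matrix_matrix_mult_def Q_def sum_distrib_left)
      also have "\<dots> = (\<Sum>k<r. \<Sum>l\<in>UNIV. C $ i $ l * (cnj (w k $ l) * w k $ j))"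
        by (rule sum.swap)
      also have "\<dots> = (\<Sum>k<r. cdot (w k) (row i C) *s w k) $ j"
        by (simp add: cdot_def row_def sum_distrib_right sum_distrib_left mult_ac)
      also have "\<dots> = row i C $ j" using complete[OF that[of i]] by simp
      finally show ?thesis by (simp add: row_def)
    qed
    then show ?thesis by (simp add: vec_eq_iff)
  qed
  have rowQ: "row i Q = (\<Sum>k<r. cnj (w k $ i) *s w k)" for i
    by (simp add: vec_eq_iff row_def Q_def)
  have "row i Q \<in> ?S" for i
    unfolding rowQ by (intro vec.span_sum vec.span_scale) (use w(1) in auto)
  then have QQ: "Q ** Q = Q" by (rule absorb)
  have BQ: "B ** Q = B" by (rule absorb) (auto simp: rows_def intro: vec.span_base)
  have herm: "ctransp Q = Q" by (simp add: ctransp_def Q_def vec_eq_iff mult.commute)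
  have "trace Q = (\<Sum>i\<in>UNIV. \<Sum>k<r. cnj (w k $ i) * w k $ i)" by (simp add: trace_def Q_def)
  also have "\<dots> = (\<Sum>k<r. cdot (w k) (w k))" unfolding cdot_def by (rule sum.swap)
  also have "\<dots> = of_nat r" using w(2) by (simp add: orthonormal_on_def)
  finally have "Re (trace Q) \<le> real K" using r by simp
  moreover have "(norm (Q *v x))\<^sup>2 \<le> x \<bullet> (Q *v x)" for x
    by (simp add: power2_norm_eq_inner inner_adjoint herm matrix_vector_mul_assoc QQ)
  ultimately show ?thesis using herm QQ BQ by (auto simp: relaxed_projections_def)
qed

section \<open>A convex minorant\<close>

text \<open>
  Pythagoras: \<open>B - F = (B - F Q) - (F - F Q)\<close>, where the first matrix is fixed and the second one is
  annihilated by multiplication with \<open>Q\<close> from the right.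
\<close>
lemma distance_split:
  fixes B F :: "complex^'q^'p"
  assumes herm: "ctransp Q = Q" and QQ: "Q ** Q = Q" and BQ: "B ** Q = B"
  shows "(norm (B - F))\<^sup>2 = (norm (B - F ** Q))\<^sup>2 + (norm F)\<^sup>2 - F \<bullet> (F ** Q)"
proof -
  let ?D = "B - F ** Q" and ?E = "F - F ** Q"
  have D: "?D ** Q = ?D" and E: "?E ** Q = 0"
    by (simp_all add: matrix_diff_rdistrib BQ matrix_mul_assoc[symmetric] QQ)
  have DE: "?D \<bullet> ?E = 0"
    using inner_matrix_right[of ?D Q ?E] by (simp only: D E herm inner_zero_right)
  have FQ: "(F ** Q) \<bullet> (F ** Q) = F \<bullet> (F ** Q)"
    by (simp add: inner_matrix_right herm matrix_mul_assoc[symmetric] QQ)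
  have "(norm (?D - ?E))\<^sup>2 = (norm ?D)\<^sup>2 + (norm ?E)\<^sup>2"
    unfolding power2_norm_eq_inner using DE by (simp add: inner_diff_left inner_diff_right inner_commute)
  moreover have "(norm ?E)\<^sup>2 = (norm F)\<^sup>2 - F \<bullet> (F ** Q)"
    unfolding power2_norm_eq_inner using FQ by (simp add: inner_diff inner_commute)
  ultimately show ?thesis by simp
qed

text \<open>
  The minimum over \<open>Q\<close> of the jointly convex function
  \<open>\<parallel>A - F Q\<parallel>\<^sup>2 + \<parallel>F\<parallel>\<^sup>2 - \<langle>F, F Q\<rangle>\<close> is convex in \<open>A\<close>, and at a matrix of rank at most \<open>K\<close> it is at
  most the squared distance from \<open>F\<close>, as the projection of \<open>rank_le_projection\<close> shows.
\<close>
lemma convex_envelope_lower_bound: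
  fixes F A :: "complex^'q^'p"
  shows "\<exists>Q\<in>relaxed_projections K.
           ereal ((norm (A - F ** Q))\<^sup>2 + (norm F)\<^sup>2 - F \<bullet> (F ** Q))
             \<le> convex_envelope (rank_functional K F) A"
proof -
  let ?RP = "relaxed_projections K :: (complex^'q^'q) set"
  define h where "h A Q = (norm (A - F ** Q))\<^sup>2 + (norm F)\<^sup>2 - F \<bullet> (F ** Q)" for A Q
  have "0 \<in> ?RP" by (simp add: relaxed_projections_def ctransp_def trace_def vec_eq_iff)
  then have ne: "?RP \<noteq> {}" by blast
  have "\<exists>Q\<in>?RP. \<forall>R\<in>?RP. h A Q \<le> h A R" for A
  proof (rule continuous_attains_inf[OF relaxed_projections_compact ne])
    show "continuous_on ?RP (h A)"
      unfolding h_def matrix_matrix_mult_def by (intro continuous_intros)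
  qed
  then obtain q where q: "\<And>A. q A \<in> ?RP" "\<And>A R. R \<in> ?RP \<Longrightarrow> h A (q A) \<le> h A R" by metis
  define g where "g A = h A (q A)" for A
  have "ereal_convex (\<lambda>A. ereal (g A))"
    unfolding ereal_convex_def
  proof (intro allI impI)
    fix x y :: "complex^'q^'p" and t :: real
    assume t: "0 < t \<and> t < 1"
    let ?Q = "(1 - t) *\<^sub>R q x + t *\<^sub>R q y" and ?z = "(1 - t) *\<^sub>R x + t *\<^sub>R y"
    have FQ: "F ** ?Q = (1 - t) *\<^sub>R (F ** q x) + t *\<^sub>R (F ** q y)"
      by (simp add: matrix_add_ldistrib matrix_mult_scaleR)
    have "g ?z \<le> h ?z ?Q"
      unfolding g_def using t q(1) by (intro q(2) relaxed_projections_convex) auto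
    also have "?z - F ** ?Q = (1 - t) *\<^sub>R (x - F ** q x) + t *\<^sub>R (y - F ** q y)"
      unfolding FQ by (simp add: algebra_simps)
    then have "h ?z ?Q \<le> (1 - t) * (norm (x - F ** q x))\<^sup>2 + t * (norm (y - F ** q y))\<^sup>2
        + (norm F)\<^sup>2 - F \<bullet> (F ** ?Q)"
      unfolding h_def using norm_square_convex[of t "x - F ** q x" "y - F ** q y"] t by simp
    also have "\<dots> = (1 - t) * g x + t * g y"
      unfolding FQ g_def h_def by (simp add: inner_add_right algebra_simps)
    finally show "ereal (g ?z) \<le> ereal (1 - t) * ereal (g x) + ereal t * ereal (g y)" by simp
  qed
  moreover have "(\<lambda>A. ereal (g A)) \<le> rank_functional K F"
  proof (rule le_funI)
    fix B :: "complex^'q^'p"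
    show "ereal (g B) \<le> rank_functional K F B"
    proof (cases "rank B \<le> K")
      case True
      then obtain Q where "Q \<in> ?RP" "Q ** Q = Q" "B ** Q = B" using rank_le_projection by blast
      then have "g B \<le> (norm (B - F))\<^sup>2"
        using q(2)[of Q B] distance_split[of Q B F] by (simp add: g_def h_def relaxed_projectionsD)
      then show ?thesis using True by (simp add: rank_functional_def rank_indicator_def)
    qed (simp add: rank_functional_def rank_indicator_def)
  qed
  ultimately have "ereal (g A) \<le> convex_envelope (rank_functional K F) A"
    using convex_envelope_greatest(3)[of "\<lambda>A. ereal (g A)"] by (simp add: le_fun_def)
  then show ?thesis using q(1) by (auto simp: g_def h_def)
qed

section \<open>The energy captured by a relaxed projection\<close>

lemma captured_energy_eq:
  fixes U :: "complex^('n::{finite,linorder})^'p" and V :: "complex^('n::{finite,linorder})^'q"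
  assumes U: "ctransp U ** U = mat 1" and F: "F = U ** diag_mat \<phi> ** ctransp V"
  shows "F \<bullet> (F ** Q) = (\<Sum>i\<in>UNIV. (\<phi> (pos i))\<^sup>2 * Re ((ctransp V ** Q ** V) $ i $ i))"
proof -
  let ?D = "diag_mat \<phi> :: complex^('n::{finite,linorder})^('n::{finite,linorder})" and ?H = "ctransp V ** Q ** V"
  have "F \<bullet> (F ** Q) = (U ** ?D) \<bullet> (U ** (?D ** ?H))"
    unfolding F by (simp add: inner_matrix_right matrix_mul_assoc)
  also have "\<dots> = ?D \<bullet> (?D ** ?H)"
    unfolding inner_matrix_left by (simp add: matrix_mul_assoc U)
  also have "\<dots> = (\<Sum>i\<in>UNIV. (\<phi> (pos i))\<^sup>2 * Re (?H $ i $ i))"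
  proof -
    have "(?D ** ?H) $ i $ j = of_real (\<phi> (pos i)) * ?H $ i $ j" for i j
      by (rule diag_mat_mult_entry)
    moreover have "?D $ i $ j \<bullet> z = (if i = j then \<phi> (pos i) * Re z else 0)" for i j z
      by (simp add: diag_mat_def inner_complex_def)
    ultimately show ?thesis by (simp add: inner_vec_def power2_eq_square mult.assoc)
  qed
  finally show ?thesis .
qed

lemma norm_factored:
  fixes U :: "complex^('n::{finite,linorder})^'p" and V :: "complex^('n::{finite,linorder})^'q"
  assumes U: "ctransp U ** U = mat 1" and V: "ctransp V ** V = mat 1"
  shows "(norm (U ** diag_mat \<phi> ** ctransp V))\<^sup>2 = (\<Sum>j=1..CARD('n). (\<phi> j)\<^sup>2)"
  using captured_energy_eq[OF U refl, of \<phi> V "mat 1"]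
  by (simp add: power2_norm_eq_inner V mat_def[of 1, symmetric] sum_pos[of "\<lambda>j. (\<phi> j)\<^sup>2"])
     (simp add: mat_def sum_pos[of "\<lambda>j. (\<phi> j)\<^sup>2"])

text \<open>
  The difference of the two sides is a sum of nonnegative terms: each unit of weight missing from an
  index up to \<open>K\<close> or placed beyond \<open>K\<close> costs the distance of \<open>\<phi> j\<^sup>2\<close> from \<open>\<phi> K\<^sup>2\<close>, and unused total
  weight costs \<open>\<phi> K\<^sup>2\<close> per unit. Equality makes every term vanish.
\<close>
lemma weighted_sum_le_top:
  fixes \<phi> h :: "nat \<Rightarrow> real"
  assumes \<phi>: "antimono_on {1..N} \<phi>" "\<And>j. j \<in> {1..N} \<Longrightarrow> 0 \<le> \<phi> j"
    and K: "1 \<le> K" "K \<le> N"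
    and h: "\<And>j. j \<in> {1..N} \<Longrightarrow> 0 \<le> h j" "\<And>j. j \<in> {1..N} \<Longrightarrow> h j \<le> 1"
    and sum_h: "(\<Sum>j=1..N. h j) \<le> real K"
  shows "(\<Sum>j=1..N. (\<phi> j)\<^sup>2 * h j) \<le> (\<Sum>j=1..K. (\<phi> j)\<^sup>2)"
    and "(\<Sum>j=1..N. (\<phi> j)\<^sup>2 * h j) = (\<Sum>j=1..K. (\<phi> j)\<^sup>2) \<Longrightarrow>
           (\<forall>j\<in>{1..N}. \<phi> K < \<phi> j \<longrightarrow> h j = 1) \<and>
           (\<forall>j\<in>{1..N}. \<phi> j < \<phi> K \<longrightarrow> h j = 0) \<and>
           (0 < \<phi> K \<longrightarrow> (\<Sum>j=1..N. h j) = real K)"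
proof -
  define s where "s = \<phi> K"
  define g where "g j = (if j \<le> K then ((\<phi> j)\<^sup>2 - s\<^sup>2) * (1 - h j) else (s\<^sup>2 - (\<phi> j)\<^sup>2) * h j)" for j
  have s0: "0 \<le> s" using \<phi>(2) K by (simp add: s_def)
  have mono: "j \<le> K \<Longrightarrow> s \<le> \<phi> j" "K \<le> j \<Longrightarrow> \<phi> j \<le> s" if "j \<in> {1..N}" for j
    using \<phi>(1) K that by (auto simp: monotone_on_def s_def)
  have g0: "0 \<le> g j" if "j \<in> {1..N}" for j
    using mono[OF that] s0 h[OF that] \<phi>(2)[OF that] by (auto simp: g_def power_mono intro!: mult_nonneg_nonneg)
  have top: "(\<Sum>j=1..N. if j \<le> K then f j else 0) = (\<Sum>j=1..K. f j)" for f :: "nat \<Rightarrow> real"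
  proof -
    have "{1..N} \<inter> {j. j \<le> K} = {1..K}" using K by auto
    then show ?thesis by (simp add: sum.If_cases)
  qed
  have "(\<Sum>j=1..N. g j) = (\<Sum>j=1..N. (if j \<le> K then (\<phi> j)\<^sup>2 else 0) - (\<phi> j)\<^sup>2 * h j
      - s\<^sup>2 * (if j \<le> K then 1 else 0) + s\<^sup>2 * h j)"
    by (intro sum.cong) (auto simp: g_def algebra_simps)
  also have "\<dots> = (\<Sum>j=1..K. (\<phi> j)\<^sup>2) - (\<Sum>j=1..N. (\<phi> j)\<^sup>2 * h j)
      - s\<^sup>2 * real K + s\<^sup>2 * (\<Sum>j=1..N. h j)"
    by (simp only: sum.distrib sum_subtractf sum_distrib_left[symmetric] top) simp
  finally have gap: "(\<Sum>j=1..K. (\<phi> j)\<^sup>2) - (\<Sum>j=1..N. (\<phi> j)\<^sup>2 * h j)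
      = (\<Sum>j=1..N. g j) + s\<^sup>2 * (real K - (\<Sum>j=1..N. h j))" by (simp add: algebra_simps)
  have nn: "0 \<le> (\<Sum>j=1..N. g j)" "0 \<le> s\<^sup>2 * (real K - (\<Sum>j=1..N. h j))"
    using g0 sum_h by (auto intro: sum_nonneg)
  show "(\<Sum>j=1..N. (\<phi> j)\<^sup>2 * h j) \<le> (\<Sum>j=1..K. (\<phi> j)\<^sup>2)" using gap nn by linarith
  assume "(\<Sum>j=1..N. (\<phi> j)\<^sup>2 * h j) = (\<Sum>j=1..K. (\<phi> j)\<^sup>2)"
  then have z: "(\<Sum>j=1..N. g j) = 0" "s\<^sup>2 * (real K - (\<Sum>j=1..N. h j)) = 0"
    using gap nn by linarith+
  have gz: "g j = 0" if "j \<in> {1..N}" for j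
    using z(1) g0 that by (subst (asm) sum_nonneg_eq_0_iff) auto
  have "h j = 1" if "j \<in> {1..N}" "s < \<phi> j" for j
  proof -
    have "j \<le> K" using mono(2)[OF that(1)] that(2) by linarith
    moreover have "s\<^sup>2 < (\<phi> j)\<^sup>2" using that(2) s0 by (intro power_strict_mono) auto
    ultimately show ?thesis using gz[OF that(1)] by (simp add: g_def)
  qed
  moreover have "h j = 0" if "j \<in> {1..N}" "\<phi> j < s" for j
  proof -
    have "\<not> j \<le> K" using mono(1)[OF that(1)] that(2) by linarith
    moreover have "(\<phi> j)\<^sup>2 < s\<^sup>2" using that(2) \<phi>(2)[OF that(1)] by (intro power_strict_mono) auto
    ultimately show ?thesis using gz[OF that(1)] by (simp add: g_def)
  qed
  moreover have "(\<Sum>j=1..N. h j) = real K" if "0 < s" using z(2) that by simp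
  ultimately show "(\<forall>j\<in>{1..N}. \<phi> K < \<phi> j \<longrightarrow> h j = 1) \<and>
           (\<forall>j\<in>{1..N}. \<phi> j < \<phi> K \<longrightarrow> h j = 0) \<and>
           (0 < \<phi> K \<longrightarrow> (\<Sum>j=1..N. h j) = real K)" by (simp add: s_def)
qed

section \<open>Vertices of the hypersimplex\<close>

text \<open>
  A property that survives convex combinations holds on the whole hypersimplex once it holds at its
  vertices. Since the sum is an integer, a point with one fractional entry has a second one; moving mass
  between the two in either direction until an entry hits \<open>0\<close> or \<open>1\<close> writes the point as a convex
  combination of two points with fewer fractional entries.
\<close>
lemma hypersimplex_vertices:
  fixes x :: "nat \<Rightarrow> real"
  assumes A: "finite A"
    and x: "\<And>j. j \<in> A \<Longrightarrow> 0 \<le> x j \<and> x j \<le> 1" "(\<Sum>j\<in>A. x j) = real k"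
    and conv: "\<And>y z t. P y \<Longrightarrow> P z \<Longrightarrow> 0 \<le> t \<Longrightarrow> t \<le> 1 \<Longrightarrow> P (\<lambda>j. (1 - t) * y j + t * z j)"
    and vertex: "\<And>y. (\<And>j. j \<in> A \<Longrightarrow> y j = 0 \<or> y j = 1) \<Longrightarrow> (\<Sum>j\<in>A. y j) = real k \<Longrightarrow> P y"
  shows "P x"
  using x
proof (induction "card {j\<in>A. 0 < x j \<and> x j < 1}" arbitrary: x rule: less_induct)
  case less
  show ?case
  proof (cases "{j\<in>A. 0 < x j \<and> x j < 1} = {}")
    case True
    then show ?thesis using less.prems by (intro vertex) force+
  next
    case False
    then obtain a where a: "a \<in> A" "0 < x a" "x a < 1" by auto
    have "\<exists>b\<in>A. b \<noteq> a \<and> 0 < x b \<and> x b < 1"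
    proof (rule ccontr)
      assume n: "\<not> (\<exists>b\<in>A. b \<noteq> a \<and> 0 < x b \<and> x b < 1)"
      have "x j \<in> \<int>" if "j \<in> A - {a}" for j
      proof -
        have "x j = 0 \<or> x j = 1" using n less.prems(1)[of j] that by force
        then show ?thesis by auto
      qed
      then have "(\<Sum>j\<in>A - {a}. x j) \<in> \<int>" by (intro Ints_sum)
      moreover have "x a = real k - (\<Sum>j\<in>A - {a}. x j)"
        using less.prems(2) sum.remove[OF A a(1), of x] by simp
      ultimately have "x a \<in> \<int>" by (metis Ints_diff Ints_of_nat)
      then obtain z where "x a = of_int z" by (auto elim: Ints_cases)
      then show False using a by simp
    qed
    then obtain b where b: "b \<in> A" "b \<noteq> a" "0 < x b" "x b < 1" by blast
    define y where "y d = (\<lambda>j. x j + (if j = a then d else 0) - (if j = b then d else 0))" for d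
    have P_y: "P (y d)" if d: "0 \<le> x a + d" "x a + d \<le> 1" "0 \<le> x b - d" "x b - d \<le> 1"
      and hit: "x a + d = 0 \<or> x a + d = 1 \<or> x b - d = 0 \<or> x b - d = 1" for d
    proof (rule less.hyps)
      have "{j\<in>A. 0 < y d j \<and> y d j < 1} \<subseteq> {j\<in>A. 0 < x j \<and> x j < 1}"
        using a b by (auto simp: y_def split: if_splits)
      moreover have "\<exists>c\<in>{a, b}. c \<notin> {j\<in>A. 0 < y d j \<and> y d j < 1}"
        using hit b(2) by (auto simp: y_def)
      then have "{j\<in>A. 0 < y d j \<and> y d j < 1} \<noteq> {j\<in>A. 0 < x j \<and> x j < 1}"
        using a b by blast
      ultimately show "card {j\<in>A. 0 < y d j \<and> y d j < 1} < card {j\<in>A. 0 < x j \<and> x j < 1}"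
        using A by (intro psubset_card_mono) auto
      show "0 \<le> y d j \<and> y d j \<le> 1" if "j \<in> A" for j
        using less.prems(1)[OF that] d by (auto simp: y_def)
      show "(\<Sum>j\<in>A. y d j) = real k"
        using less.prems(2) A a(1) b(1) by (simp add: y_def sum.distrib sum_subtractf)
    qed
    \<comment> \<open>The largest shifts from \<open>b\<close> to \<open>a\<close> and from \<open>a\<close> to \<open>b\<close> that stay within \<open>[0, 1]\<close>.\<close>
    define d where "d = min (1 - x a) (x b)"
    define e where "e = min (x a) (1 - x b)"
    have de: "d > 0" "e > 0" using a b by (auto simp: d_def e_def)
    have "P (y d)" using a b by (intro P_y) (auto simp: d_def min_def)
    moreover have "P (y (- e))" using a b by (intro P_y) (auto simp: e_def min_def)
    moreover have "0 \<le> d / (d + e)" "d / (d + e) \<le> 1" using de by auto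
    ultimately have "P (\<lambda>j. (1 - d / (d + e)) * y d j + d / (d + e) * y (- e) j)" by (rule conv)
    moreover have "(\<lambda>j. (1 - d / (d + e)) * y d j + d / (d + e) * y (- e) j) = x"
    proof
      fix j
      have t: "(1 - d / (d + e)) * d = d / (d + e) * e" using de by (simp add: field_simps)
      have "(1 - d / (d + e)) * y d j + d / (d + e) * y (- e) j
          = x j + ((1 - d / (d + e)) * d - d / (d + e) * e) * ((if j = a then 1 else 0) - (if j = b then 1 else 0))"
        by (simp add: y_def algebra_simps)
      then show "(1 - d / (d + e)) * y d j + d / (d + e) * y (- e) j = x j" using t by simp
    qed
    ultimately show ?thesis by simp
  qed
qed

section \<open>Block diagonalisation\<close>

lemma diag_mat_mult: "diag_mat a ** diag_mat b = diag_mat (\<lambda>j. a j * b j)"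
  by (simp add: vec_eq_iff diag_mat_mult_entry) (simp add: diag_mat_def)

text \<open>
  \<open>H\<close> maps the span of the basis vectors \<open>J, \<dots>, L\<close> to itself because it is Hermitian and acts as a
  scalar on the others. Replacing these basis vectors by eigenvectors from the same span gives \<open>X\<close>, which
  commutes with every diagonal matrix that is constant on the block.
\<close>
lemma block_diagonalisation:
  fixes H :: "complex^('n::{finite,linorder})^('n::{finite,linorder})"
  assumes herm: "ctransp H = H" and JL: "1 \<le> J" "J \<le> L" "L \<le> CARD('n)"
    and top: "\<And>i. pos i < J \<Longrightarrow> H *v axis i 1 = axis i 1"
    and bot: "\<And>i. L < pos i \<Longrightarrow> H *v axis i 1 = 0"
  shows "\<exists>(X :: complex^('n::{finite,linorder})^('n::{finite,linorder})) d. ctransp X ** X = mat 1 \<and> H = X ** diag_mat d ** ctransp X \<and>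
           (\<forall>j<J. d j = 1) \<and> (\<forall>j>L. d j = 0) \<and> antimono_on {J..L} d \<and>
           (\<forall>\<phi>. (\<forall>j\<in>{J..L}. \<phi> j = \<phi> J) \<longrightarrow> diag_mat \<phi> ** X = X ** diag_mat \<phi>)"
proof -
  let ?B = "{i :: 'n. J \<le> pos i \<and> pos i \<le> L}"
  let ?S = "{x :: complex^('n::{finite,linorder}). \<forall>i. i \<notin> ?B \<longrightarrow> x $ i = 0}"
  have "pos ` ?B = {J..L}"
  proof (intro set_eqI iffI)
    fix j assume j: "j \<in> {J..L}"
    then have "j \<in> range (pos :: 'n \<Rightarrow> nat)"
      using bij_betw_pos[where 'n = 'n] JL by (simp add: bij_betw_def)
    then show "j \<in> pos ` ?B" using j by auto
  qed auto
  moreover have "card (pos ` ?B) = card ?B"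
    by (intro card_image) (simp add: inj_on_def inj_pos)
  ultimately have "card ?B = L + 1 - J" by simp
  then have dim: "vec.dim ?S = L + 1 - J" by (simp only: dim_substandard_cart)
  have inv: "H *v x \<in> ?S" if "x \<in> ?S" for x
  proof -
    have "(H *v x) $ i = 0" if i: "i \<notin> ?B" for i
    proof -
      have "(H *v x) $ i = cdot (H *v axis i 1) x"
        by (simp add: cdot_adjoint herm cdot_axis_left)
      moreover have "pos i < J \<or> L < pos i" using i by auto
      moreover have "x $ i = 0" using i \<open>x \<in> ?S\<close> by blast
      ultimately show ?thesis using top bot by (auto simp: cdot_axis_left)
    qed
    then show ?thesis by blast
  qed
  obtain w l where w: "\<And>i. i < L + 1 - J \<Longrightarrow> w i \<in> ?S \<and> H *v w i = of_real (l i) *s w i"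
    and on: "orthonormal_on {..<L + 1 - J} w" and l: "antimono_on {..<L + 1 - J} l"
    using spectral_theorem[OF herm subspace_substandard_cart inv dim] by blast
  define x where "x i = (if i \<in> ?B then w (pos i - J) else axis i 1)" for i
  define d where "d j = (if j < J then 1 else if j \<le> L then l (j - J) else 0)" for j
  define X :: "complex^('n::{finite,linorder})^('n::{finite,linorder})" where "X = (\<chi> i j. x j $ i)"
  have col: "column j X = x j" for j by (simp add: X_def column_def vec_eq_iff)
  have idx: "pos i - J < L + 1 - J" if "i \<in> ?B" for i using that JL by auto
  have Hx: "H *v x i = of_real (d (pos i)) *s x i" for i
    using w[OF idx, of i] top[of i] bot[of i] by (auto simp: x_def d_def)
  have sep: "cdot (x i) (x j) = (if i = j then 1 else 0)" for i j
  proof (cases "i \<in> ?B"; cases "j \<in> ?B")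
    assume ij: "i \<in> ?B" "j \<in> ?B"
    then have "pos i - J = pos j - J \<longleftrightarrow> i = j" using inj_pos[of i j] by auto
    then show ?thesis using ij idx on by (simp add: x_def orthonormal_on_def)
  next
    assume ij: "i \<in> ?B" "j \<notin> ?B"
    have "w (pos i - J) $ j = 0" using ij w[OF idx[OF ij(1)]] by blast
    then have "cdot (x j) (x i) = 0"
      unfolding x_def if_P[OF ij(1)] if_not_P[OF ij(2)] by (simp add: cdot_axis_left)
    then have "cdot (x i) (x j) = 0" by (metis cnj_cdot complex_cnj_zero)
    then show ?thesis using ij by auto
  next
    assume ij: "i \<notin> ?B" "j \<in> ?B"
    have "w (pos j - J) $ i = 0" using ij w[OF idx[OF ij(2)]] by blast
    then have "cdot (x i) (x j) = 0"
      unfolding x_def if_P[OF ij(2)] if_not_P[OF ij(1)] by (simp add: cdot_axis_left)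
    then show ?thesis using ij by auto
  qed (auto simp: x_def cdot_axis_axis)
  have XX: "ctransp X ** X = mat 1" by (simp add: isometry_iff_columns col sep)
  then have XX': "X ** ctransp X = mat 1" by (simp add: matrix_left_right_inverse)
  have "H ** X = X ** diag_mat d"
  proof -
    have "column j (H ** X) = column j (X ** diag_mat d)" for j
      by (simp only: column_mult_diag_mat column_matrix_mult[of _ H] col Hx)
    then show ?thesis by (rule matrix_eq_columnsI)
  qed
  then have HX: "H = X ** diag_mat d ** ctransp X" by (metis XX' matrix_mul_assoc matrix_mul_rid)
  have comm: "diag_mat \<phi> ** X = X ** diag_mat \<phi>" if \<phi>: "\<forall>j\<in>{J..L}. \<phi> j = \<phi> J" for \<phi>
  proof -
    have "\<phi> (pos i) = \<phi> (pos j)" if "X $ i $ j \<noteq> 0" for i j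
    proof (cases "j \<in> ?B")
      case True
      then have "X $ i $ j = w (pos j - J) $ i" by (simp add: X_def x_def)
      then have "i \<in> ?B" using that w[OF idx[OF True]] by auto
      then show ?thesis using True \<phi> by (metis (mono_tags, lifting) atLeastAtMost_iff mem_Collect_eq)
    next
      case False
      then show ?thesis using that by (auto simp: X_def x_def axis_def split: if_splits)
    qed
    then show ?thesis by (auto simp: vec_eq_iff diag_mat_mult_entry mult_diag_mat_entry)
  qed
  have anti: "antimono_on {J..L} d"
    using l by (auto simp: d_def monotone_on_def)
  have ends: "\<forall>j<J. d j = 1" "\<forall>j>L. d j = 0" using JL by (auto simp: d_def)
  show ?thesis
    by (rule exI[of _ X], rule exI[of _ d]) (intro conjI XX HX ends anti allI impI comm)
qed

section \<open>Structure of the minimisers\<close>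

lemma multiplicity_block:
  fixes \<phi> :: "nat \<Rightarrow> real"
  assumes \<phi>: "antimono_on {1..N} \<phi>" and K: "1 \<le> K" "K \<le> N"
    and J: "J = Min {j\<in>{1..N}. \<phi> j = \<phi> K}" and L: "L = Max {j\<in>{1..N}. \<phi> j = \<phi> K}"
  shows "1 \<le> J" "J \<le> K" "K \<le> L" "L \<le> N"
    and "\<And>j. 1 \<le> j \<Longrightarrow> j < J \<Longrightarrow> \<phi> K < \<phi> j"
    and "\<And>j. J \<le> j \<Longrightarrow> j \<le> L \<Longrightarrow> \<phi> j = \<phi> K"
    and "\<And>j. L < j \<Longrightarrow> j \<le> N \<Longrightarrow> \<phi> j < \<phi> K"
proof -
  let ?S = "{j\<in>{1..N}. \<phi> j = \<phi> K}"
  have fin: "finite ?S" and KS: "K \<in> ?S" using K by auto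
  have JS: "J \<in> ?S" unfolding J using fin KS by (intro Min_in) auto
  have LS: "L \<in> ?S" unfolding L using fin KS by (intro Max_in) auto
  show JK: "J \<le> K" unfolding J using fin KS by (intro Min_le)
  show KL: "K \<le> L" unfolding L using fin KS by (intro Max_ge)
  show J1: "1 \<le> J" and LN: "L \<le> N" using JS LS by auto
  have mono: "\<phi> j \<le> \<phi> i" if "1 \<le> i" "i \<le> j" "j \<le> N" for i j
    using monotone_onD[OF \<phi>, of i j] that by auto
  show "\<phi> K < \<phi> j" if "1 \<le> j" "j < J" for j
  proof -
    have "j \<notin> ?S" using that(2) fin unfolding J by (metis Min_le not_less)
    then have "\<phi> j \<noteq> \<phi> K" using that JK K by auto
    then show ?thesis using mono[of j K] that JK K by auto
  qed
  show "\<phi> j < \<phi> K" if "L < j" "j \<le> N" for j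
  proof -
    have "j \<notin> ?S" using that(1) fin unfolding L by (metis Max_ge not_less)
    then have "\<phi> j \<noteq> \<phi> K" using that KL K by auto
    then show ?thesis using mono[of K j] that KL K by auto
  qed
  show "\<phi> j = \<phi> K" if "J \<le> j" "j \<le> L" for j
    using mono[of J j] mono[of j L] that J1 LN JS LS by auto
qed

lemma is_svdD:
  assumes "is_svd F (U :: complex^('n::{finite,linorder})^'p) \<phi> (V :: complex^('n::{finite,linorder})^'q)"
  shows "ctransp U ** U = mat 1" "ctransp V ** V = mat 1" "F = U ** diag_mat \<phi> ** ctransp V"
    "antimono_on {1..CARD('n)} \<phi>" "\<And>j. j \<in> {1..CARD('n)} \<Longrightarrow> 0 \<le> \<phi> j"
  using assms by (simp_all add: is_svd_def singular_values_def Let_def)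

lemma compression_diagonal:
  fixes H :: "complex^('n::{finite,linorder})^('n::{finite,linorder})"
  assumes H: "H \<in> relaxed_projections K"
  shows "0 \<le> Re (H $ i $ i)" "Re (H $ i $ i) \<le> 1"
    and "Re (H $ i $ i) = 1 \<Longrightarrow> H *v axis i 1 = axis i 1" "Re (H $ i $ i) = 0 \<Longrightarrow> H *v axis i 1 = 0"
proof -
  have "axis i 1 \<bullet> (H *v axis i 1) = Re (H $ i $ i)"
    by (simp add: Re_cdot[symmetric] cdot_axis_left mult_axis column_def)
  then show "0 \<le> Re (H $ i $ i)" "Re (H $ i $ i) \<le> 1"
    "Re (H $ i $ i) = 1 \<Longrightarrow> H *v axis i 1 = axis i 1" "Re (H $ i $ i) = 0 \<Longrightarrow> H *v axis i 1 = 0"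
    using relaxed_projections_unit[OF H norm_axis_complex[of i]] by simp_all
qed

lemma tail_energy:
  fixes \<phi> :: "nat \<Rightarrow> real"
  assumes "K \<le> N"
  shows "(\<Sum>j=1..N. (\<phi> j)\<^sup>2) - (\<Sum>j=1..K. (\<phi> j)\<^sup>2) = (\<Sum>j=K+1..N. (\<phi> j)\<^sup>2)"
proof -
  have "{1..N} = {1..K} \<union> {K+1..N}" using assms by auto
  then show ?thesis by (simp only:) (subst sum.union_disjoint, auto)
qed

text \<open>
  For \<open>\<phi> K = 0\<close> the total weight is not determined, so nothing is known about \<open>Q\<close> outside the range of
  \<open>V\<close>; but then \<open>Q\<close> fixes every right singular vector with a nonzero singular value, and \<open>F Q = F\<close>.
\<close>
lemma envelope_analysis:
  fixes U :: "complex^('n::{finite,linorder})^'p" and V :: "complex^('n::{finite,linorder})^'q"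
  assumes svd: "is_svd F U \<phi> V" and N: "N = CARD('n)" and K: "1 \<le> K" "K \<le> N"
  shows "ereal (\<Sum>j=K+1..N. (\<phi> j)\<^sup>2) \<le> convex_envelope (rank_functional K F) A"
    and "convex_envelope (rank_functional K F) A \<le> ereal (\<Sum>j=K+1..N. (\<phi> j)\<^sup>2) \<Longrightarrow>
      (\<phi> K = 0 \<longrightarrow> A = F) \<and>
      (0 < \<phi> K \<longrightarrow> (\<exists>H\<in>relaxed_projections K. A = U ** diag_mat \<phi> ** H ** ctransp V \<and>
          (\<forall>i. \<phi> K < \<phi> (pos i) \<longrightarrow> H *v axis i 1 = axis i 1) \<and>
          (\<forall>i. \<phi> (pos i) < \<phi> K \<longrightarrow> H *v axis i 1 = 0) \<and> Re (trace H) = real K))"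
proof -
  note D = is_svdD[OF svd]
  let ?c = "\<Sum>j=K+1..N. (\<phi> j)\<^sup>2" and ?env = "convex_envelope (rank_functional K F) A"
  obtain Q where Q: "Q \<in> relaxed_projections K"
    and lower: "ereal ((norm (A - F ** Q))\<^sup>2 + (norm F)\<^sup>2 - F \<bullet> (F ** Q)) \<le> ?env"
    using convex_envelope_lower_bound by blast
  define H where "H = ctransp V ** Q ** V"
  have H: "H \<in> relaxed_projections K" unfolding H_def by (rule compression_relaxed[OF Q D(2)])
  \<comment> \<open>The diagonal of \<open>H\<close>, transported from the index type to \<open>{1..N}\<close>.\<close>
  define h where "h j = Re (H $ inv pos j $ inv pos j)" for j
  have h_pos: "h (pos i) = Re (H $ i $ i)" for i
    using strict_mono_imp_inj_on[OF strict_mono_pos[where 'n = 'n]] by (simp add: h_def inv_f_f)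
  have h01: "0 \<le> h j" "h j \<le> 1" for j
    using compression_diagonal(1,2)[OF H] by (auto simp: h_def)
  have sum_h: "(\<Sum>j=1..N. h j) = Re (trace H)"
    using sum_pos[of h, where 'n = 'n] by (simp add: h_pos trace_def N)
  have energy: "F \<bullet> (F ** Q) = (\<Sum>j=1..N. (\<phi> j)\<^sup>2 * h j)"
    unfolding captured_energy_eq[OF D(1,3)] H_def[symmetric] h_pos[symmetric] N by (rule sum_pos)
  have normF: "(norm F)\<^sup>2 = (\<Sum>j=1..N. (\<phi> j)\<^sup>2)"
    unfolding D(3) N by (rule norm_factored[OF D(1,2)])
  have anti: "antimono_on {1..N} \<phi>" and nn: "\<And>j. j \<in> {1..N} \<Longrightarrow> 0 \<le> \<phi> j" using D(4,5) N by auto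
  have sum_le: "(\<Sum>j=1..N. h j) \<le> real K" using sum_h relaxed_projectionsD(3)[OF H] by simp
  have W1: "(\<Sum>j=1..N. (\<phi> j)\<^sup>2 * h j) \<le> (\<Sum>j=1..K. (\<phi> j)\<^sup>2)"
    by (rule weighted_sum_le_top(1)) (use anti nn K h01 sum_le in auto)
  have "?c + (norm (A - F ** Q))\<^sup>2 + ((\<Sum>j=1..K. (\<phi> j)\<^sup>2) - (\<Sum>j=1..N. (\<phi> j)\<^sup>2 * h j))
      = (norm (A - F ** Q))\<^sup>2 + (norm F)\<^sup>2 - F \<bullet> (F ** Q)"
    using tail_energy[OF K(2), of \<phi>] unfolding energy normF by linarith
  with lower have lower': "ereal (?c + (norm (A - F ** Q))\<^sup>2 +
      ((\<Sum>j=1..K. (\<phi> j)\<^sup>2) - (\<Sum>j=1..N. (\<phi> j)\<^sup>2 * h j))) \<le> ?env" by (simp only:)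
  have "ereal ?c \<le> ereal (?c + (norm (A - F ** Q))\<^sup>2 +
      ((\<Sum>j=1..K. (\<phi> j)\<^sup>2) - (\<Sum>j=1..N. (\<phi> j)\<^sup>2 * h j)))"
    using W1 by simp
  then show "ereal ?c \<le> ?env" using lower' by (rule order.trans)
  assume "?env \<le> ereal ?c"
  with lower' have "(norm (A - F ** Q))\<^sup>2 + ((\<Sum>j=1..K. (\<phi> j)\<^sup>2) - (\<Sum>j=1..N. (\<phi> j)\<^sup>2 * h j)) \<le> 0"
    using order.trans[OF lower', of "ereal ?c"] by simp
  then have "(norm (A - F ** Q))\<^sup>2 = 0" and eq: "(\<Sum>j=1..N. (\<phi> j)\<^sup>2 * h j) = (\<Sum>j=1..K. (\<phi> j)\<^sup>2)"
    using W1 zero_le_power2[of "norm (A - F ** Q)"] by linarith+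
  then have A: "A = F ** Q" by simp
  have W2: "(\<forall>j\<in>{1..N}. \<phi> K < \<phi> j \<longrightarrow> h j = 1) \<and>
      (\<forall>j\<in>{1..N}. \<phi> j < \<phi> K \<longrightarrow> h j = 0) \<and> (0 < \<phi> K \<longrightarrow> (\<Sum>j=1..N. h j) = real K)"
    by (rule weighted_sum_le_top(2)) (use anti nn K h01 sum_le eq in auto)
  have top: "H *v axis i 1 = axis i 1" if "\<phi> K < \<phi> (pos i)" for i
    using W2 that pos_range[of i] N by (intro compression_diagonal(3)[OF H]) (auto simp: h_pos[symmetric])
  have bot: "H *v axis i 1 = 0" if "\<phi> (pos i) < \<phi> K" for i
    using W2 that pos_range[of i] N by (intro compression_diagonal(4)[OF H]) (auto simp: h_pos[symmetric])
  have zero: "A = F" if s: "\<phi> K = 0"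
  proof -
    have "Q *v column i V = column i V" if i: "\<phi> (pos i) \<noteq> 0" for i
    proof -
      have "\<phi> K < \<phi> (pos i)" using i nn[of "pos i"] pos_range[of i] N s by auto
      then have "h (pos i) = 1" using W2 pos_range[of i] N by auto
      then have "cdot (column i V) (Q *v column i V) = cdot (column i V) (Q *v column i V) \<and>
          Re (cdot (column i V) (Q *v column i V)) = 1"
        by (simp add: h_pos H_def matrix_mul_assoc[symmetric] ctransp_mult_entry column_matrix_mult)
      moreover have "norm (column i V) = 1"
        using D(2) orthonormal_on_norm[of UNIV "\<lambda>i. column i V" i]
        by (simp add: isometry_iff_columns orthonormal_on_def)
      ultimately show ?thesis using relaxed_projections_unit(3)[OF Q] by (simp add: Re_cdot)
    qed
    then have "of_real (\<phi> (pos i)) *s (Q *v column i V) = of_real (\<phi> (pos i)) *s column i V" for i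
      by (cases "\<phi> (pos i) = 0") auto
    then have "Q ** (V ** diag_mat \<phi>) = V ** diag_mat \<phi>"
      by (intro matrix_eq_columnsI)
        (simp only: column_matrix_mult[of _ Q] column_mult_diag_mat matrix_vector_mult_smult)
    then have "ctransp (Q ** (V ** diag_mat \<phi>)) = ctransp (V ** diag_mat \<phi>)" by simp
    then have DVQ: "diag_mat \<phi> ** ctransp V ** Q = diag_mat \<phi> ** ctransp V"
      by (simp only: ctransp_mult relaxed_projectionsD(1)[OF Q] ctransp_diag_mat)
    have "A = U ** (diag_mat \<phi> ** ctransp V ** Q)"
      unfolding A D(3) by (simp only: matrix_mul_assoc)
    also have "\<dots> = F" unfolding DVQ D(3) by (rule matrix_mul_assoc)
    finally show ?thesis .
  qed
  moreover have "\<exists>H\<in>relaxed_projections K. A = U ** diag_mat \<phi> ** H ** ctransp V \<and>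
          (\<forall>i. \<phi> K < \<phi> (pos i) \<longrightarrow> H *v axis i 1 = axis i 1) \<and>
          (\<forall>i. \<phi> (pos i) < \<phi> K \<longrightarrow> H *v axis i 1 = 0) \<and> Re (trace H) = real K" if s: "0 < \<phi> K"
  proof -
    have tr: "Re (trace H) = real K" using W2 s sum_h by simp
    \<comment> \<open>The compression to the range of \<open>V\<close> already has the maximal trace \<open>K\<close>, so \<open>Q\<close> vanishes off that range.\<close>
    have "(norm (Q - Q ** V ** ctransp V))\<^sup>2 \<le> 0"
      using compression_trace[OF Q D(2)] tr relaxed_projectionsD(3)[OF Q] unfolding H_def by linarith
    then have QV: "Q ** V ** ctransp V = Q" by simp
    have "ctransp V ** Q = ctransp V ** (Q ** V ** ctransp V)" by (simp only: QV)
    also have "\<dots> = H ** ctransp V" by (simp only: H_def matrix_mul_assoc)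
    finally have VQ: "ctransp V ** Q = H ** ctransp V" .
    have "A = U ** diag_mat \<phi> ** (ctransp V ** Q)"
      unfolding A D(3) by (rule matrix_mul_assoc[symmetric])
    also have "\<dots> = U ** diag_mat \<phi> ** H ** ctransp V" unfolding VQ by (rule matrix_mul_assoc)
    finally have "A = U ** diag_mat \<phi> ** H ** ctransp V" .
    then show ?thesis using H top bot tr by blast
  qed
  ultimately show "(\<phi> K = 0 \<longrightarrow> A = F) \<and>
      (0 < \<phi> K \<longrightarrow> (\<exists>H\<in>relaxed_projections K. A = U ** diag_mat \<phi> ** H ** ctransp V \<and>
          (\<forall>i. \<phi> K < \<phi> (pos i) \<longrightarrow> H *v axis i 1 = axis i 1) \<and>
          (\<forall>i. \<phi> (pos i) < \<phi> K \<longrightarrow> H *v axis i 1 = 0) \<and> Re (trace H) = real K))" by blast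
qed

section \<open>Optimal sequences\<close>

text \<open>
  The sequences \<open>\<alpha>\<close> of the theorem, with the multiplicities \<open>M = L + 1 - J\<close> and \<open>m = K + 1 - J\<close>
  substituted.
\<close>
definition optimal_sequences ::
  "(nat \<Rightarrow> real) \<Rightarrow> nat \<Rightarrow> nat \<Rightarrow> nat \<Rightarrow> nat \<Rightarrow> (nat \<Rightarrow> real) set" where
  "optimal_sequences \<phi> N K J L =
     {\<alpha>. antimono_on {1..N} \<alpha> \<and> (\<forall>j. 1 \<le> j \<and> j < J \<longrightarrow> \<alpha> j = \<phi> j) \<and>
          (\<exists>x\<in>Omega (L + 1 - J) (K + 1 - J). \<forall>i\<in>{1..L + 1 - J}. \<alpha> (J + i - 1) = \<phi> K * x i) \<and>
          (\<forall>j. L < j \<and> j \<le> N \<longrightarrow> \<alpha> j = 0)}"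

text \<open>
  On the block \<open>J, \<dots>, L\<close> all singular values equal \<open>\<phi> K\<close>, so a sequence in \<open>optimal_sequences\<close> is a
  splice of \<open>\<phi>\<close> with weights \<open>y\<close> that are indexed by the block itself instead of by \<open>1, \<dots>, M\<close>.
\<close>
definition splice :: "(nat \<Rightarrow> real) \<Rightarrow> nat \<Rightarrow> nat \<Rightarrow> (nat \<Rightarrow> real) \<Rightarrow> nat \<Rightarrow> real" where
  "splice \<phi> J L y j = (if j < J then \<phi> j else if j \<le> L then \<phi> j * y j else 0)"

lemma sum_shift_block:
  fixes f :: "nat \<Rightarrow> real"
  assumes "1 \<le> J" "J \<le> L"
  shows "(\<Sum>i=1..L + 1 - J. f (J + i - 1)) = (\<Sum>j=J..L. f j)"
  by (rule sum.reindex_bij_witness[of _ "\<lambda>j. j + 1 - J" "\<lambda>i. J + i - 1"]) (use assms in auto)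

lemma splice_optimal:
  fixes \<phi> y :: "nat \<Rightarrow> real"
  assumes \<phi>: "antimono_on {1..N} \<phi>" "\<And>j. j \<in> {1..N} \<Longrightarrow> 0 \<le> \<phi> j"
    and JL: "1 \<le> J" "J \<le> K" "K \<le> L" "L \<le> N"
    and block: "\<And>j. J \<le> j \<Longrightarrow> j \<le> L \<Longrightarrow> \<phi> j = \<phi> K"
    and y: "antimono_on {J..L} y" "\<And>j. j \<in> {J..L} \<Longrightarrow> 0 \<le> y j \<and> y j \<le> 1"
      "(\<Sum>j=J..L. y j) = real (K + 1 - J)"
  shows "splice \<phi> J L y \<in> optimal_sequences \<phi> N K J L"
proof -
  have K0: "0 \<le> \<phi> K" using \<phi>(2) JL by auto
  have mono: "\<phi> j \<le> \<phi> i" if "1 \<le> i" "i \<le> j" "j \<le> N" for i j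
    using monotone_onD[OF \<phi>(1), of i j] that by auto
  have "antimono_on {1..N} (splice \<phi> J L y)"
  proof (rule monotone_onI)
    fix i j assume ij: "i \<in> {1..N}" "j \<in> {1..N}" "i \<le> j"
    consider "L < j" | "j < J" | "J \<le> i" "j \<le> L" | "i < J" "J \<le> j" "j \<le> L" by linarith
    then show "splice \<phi> J L y j \<le> splice \<phi> J L y i"
    proof cases
      case 1
      then have "splice \<phi> J L y j = 0" using JL by (simp add: splice_def)
      moreover have "0 \<le> splice \<phi> J L y i" using \<phi>(2)[OF ij(1)] y(2)[of i] by (simp add: splice_def)
      ultimately show ?thesis by simp
    next
      case 2
      then show ?thesis using mono[of i j] ij by (simp add: splice_def)
    next
      case 3
      then have "y j \<le> y i" using monotone_onD[OF y(1), of i j] ij by auto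
      then show ?thesis using 3 ij K0 block[of i] block[of j] by (simp add: splice_def mult_left_mono)
    next
      case 4
      then have "\<phi> j * y j \<le> \<phi> j * 1" using y(2)[of j] \<phi>(2)[OF ij(2)] by (intro mult_left_mono) auto
      then show ?thesis using 4 mono[of i j] ij by (simp add: splice_def)
    qed
  qed
  moreover have "(\<lambda>i. y (J + i - 1)) \<in> Omega (L + 1 - J) (K + 1 - J)"
  proof -
    have "antimono_on {1..L + 1 - J} (\<lambda>i. y (J + i - 1))"
    proof (rule monotone_onI)
      fix i k assume "i \<in> {1..L + 1 - J}" "k \<in> {1..L + 1 - J}" "i \<le> k"
      then show "y (J + k - 1) \<le> y (J + i - 1)"
        using monotone_onD[OF y(1), of "J + i - 1" "J + k - 1"] JL by auto
    qed
    moreover have "0 \<le> y (J + i - 1) \<and> y (J + i - 1) \<le> 1" if "i \<in> {1..L + 1 - J}" for i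
      using that JL by (intro y(2)) auto
    ultimately show ?thesis
      using y(3) sum_shift_block[of J L y] JL by (simp add: Omega_def)
  qed
  moreover have "splice \<phi> J L y (J + i - 1) = \<phi> K * y (J + i - 1)" if "i \<in> {1..L + 1 - J}" for i
    using that JL block[of "J + i - 1"] by (auto simp: splice_def)
  ultimately show ?thesis unfolding optimal_sequences_def using JL by (auto simp: splice_def)
qed

lemma optimal_sequence_splice:
  assumes \<alpha>: "\<alpha> \<in> optimal_sequences \<phi> N K J L"
    and JL: "1 \<le> J" "J \<le> K" "K \<le> L" "L \<le> N"
    and block: "\<And>j. J \<le> j \<Longrightarrow> j \<le> L \<Longrightarrow> \<phi> j = \<phi> K"
  shows "\<exists>y. (\<forall>j\<in>{J..L}. 0 \<le> y j \<and> y j \<le> 1) \<and> (\<Sum>j=J..L. y j) = real (K + 1 - J) \<and>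
             (\<forall>j\<in>{1..N}. \<alpha> j = splice \<phi> J L y j)"
proof -
  obtain x where x: "x \<in> Omega (L + 1 - J) (K + 1 - J)"
    and ax: "\<And>i. i \<in> {1..L + 1 - J} \<Longrightarrow> \<alpha> (J + i - 1) = \<phi> K * x i"
    using \<alpha> by (auto simp: optimal_sequences_def)
  define y where "y j = x (j + 1 - J)" for j
  have "0 \<le> y j \<and> y j \<le> 1" if "j \<in> {J..L}" for j
  proof -
    have "j + 1 - J \<in> {1..L + 1 - J}" using that by auto
    then show ?thesis using x by (auto simp: Omega_def y_def)
  qed
  moreover have "(\<Sum>j=J..L. y j) = real (K + 1 - J)"
  proof -
    have "(\<Sum>j=J..L. y j) = (\<Sum>i=1..L + 1 - J. y (J + i - 1))"
      using sum_shift_block[of J L y] JL by simp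
    also have "\<dots> = (\<Sum>i=1..L + 1 - J. x i)"
      by (intro sum.cong) (use JL in \<open>auto simp: y_def\<close>)
    finally show ?thesis using x by (simp add: Omega_def)
  qed
  moreover have "\<alpha> j = splice \<phi> J L y j" if "j \<in> {1..N}" for j
  proof -
    consider "j < J" | "L < j" | "J \<le> j" "j \<le> L" by linarith
    then show ?thesis
    proof cases
      case 3
      have "j + 1 - J \<in> {1..L + 1 - J}" "J + (j + 1 - J) - 1 = j" using 3 by auto
      then show ?thesis using 3 ax[of "j + 1 - J"] block by (simp add: splice_def y_def)
    qed (use \<alpha> that JL in \<open>auto simp: optimal_sequences_def splice_def\<close>)
  qed
  ultimately show ?thesis by blast
qed

section \<open>The minimisers\<close>

lemma diag_mat_cong:
  "(\<And>j. j \<in> {1..CARD('n)} \<Longrightarrow> a j = b j) \<Longrightarrow>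
     diag_mat a = (diag_mat b :: complex^('n::{finite,linorder})^('n::{finite,linorder}))"
  using pos_range[where 'n = 'n] by (simp add: diag_mat_def vec_eq_iff)

lemma convex_sublevel:
  assumes f: "ereal_convex f" and xy: "f x \<le> ereal c" "f y \<le> ereal c" and t: "0 \<le> t" "t \<le> 1"
  shows "f ((1 - t) *\<^sub>R x + t *\<^sub>R y) \<le> ereal c"
proof (cases "0 < t \<and> t < 1")
  case True
  then have "f ((1 - t) *\<^sub>R x + t *\<^sub>R y) \<le> ereal (1 - t) * f x + ereal t * f y"
    using f by (simp add: ereal_convex_def)
  also have "\<dots> \<le> ereal (1 - t) * ereal c + ereal t * ereal c"
    using True xy by (intro add_mono ereal_mult_left_mono) auto
  also have "\<dots> = ereal c" by (simp add: algebra_simps)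
  finally show ?thesis .
next
  case False
  then have "t = 0 \<or> t = 1" using t by auto
  then show ?thesis using xy by auto
qed

lemma factored_affine:
  fixes U :: "complex^('n::{finite,linorder})^'p" and V :: "complex^('n::{finite,linorder})^'q"
  shows "U ** diag_mat (\<lambda>j. (1 - t) * a j + t * b j) ** ctransp V =
     (1 - t) *\<^sub>R (U ** diag_mat a ** ctransp V) + t *\<^sub>R (U ** diag_mat b ** ctransp V)"
proof -
  have "diag_mat (\<lambda>j. (1 - t) * a j + t * b j) =
      (1 - t) *\<^sub>R diag_mat a + t *\<^sub>R (diag_mat b :: complex^('n::{finite,linorder})^('n::{finite,linorder}))"
    by (simp add: vec_eq_iff diag_mat_def scaleR_conv_of_real[where 'a = complex])
  then show ?thesis
    by (simp only: matrix_add_ldistrib matrix_add_rdistrib' matrix_mult_scaleR scaleR_matrix_mult)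
qed

lemma factored_distance:
  fixes U :: "complex^('n::{finite,linorder})^'p" and V :: "complex^('n::{finite,linorder})^'q"
  assumes "ctransp U ** U = mat 1" "ctransp V ** V = mat 1"
  shows "(norm (U ** diag_mat a ** ctransp V - U ** diag_mat b ** ctransp V))\<^sup>2
       = (\<Sum>j=1..CARD('n). (a j - b j)\<^sup>2)"
proof -
  have "diag_mat (\<lambda>j. a j - b j) =
      diag_mat a - (diag_mat b :: complex^('n::{finite,linorder})^('n::{finite,linorder}))"
    by (simp add: vec_eq_iff diag_mat_def)
  then have "U ** diag_mat a ** ctransp V - U ** diag_mat b ** ctransp V
      = U ** diag_mat (\<lambda>j. a j - b j) ** ctransp V"
    by (simp only: matrix_diff_ldistrib matrix_diff_rdistrib)
  then show ?thesis using norm_factored[OF assms] by simp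
qed

lemma block_sums:
  fixes f :: "nat \<Rightarrow> real"
  assumes "1 \<le> J" "J \<le> L" "L \<le> N"
  shows "(\<Sum>j=1..N. f j) = (\<Sum>j=1..<J. f j) + (\<Sum>j=J..L. f j) + (\<Sum>j=L+1..N. f j)"
proof -
  have "{1..N} = ({1..<J} \<union> {J..L}) \<union> {L+1..N}" using assms by auto
  then have "(\<Sum>j=1..N. f j) = (\<Sum>j\<in>{1..<J} \<union> {J..L}. f j) + (\<Sum>j=L+1..N. f j)"
    using assms by (simp only:) (intro sum.union_disjoint, auto)
  also have "(\<Sum>j\<in>{1..<J} \<union> {J..L}. f j) = (\<Sum>j=1..<J. f j) + (\<Sum>j=J..L. f j)"
    by (intro sum.union_disjoint) auto
  finally show ?thesis .
qed

text \<open>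
  With \<open>0/1\<close> weights one keeps exactly \<open>K\<close> of the singular values, and the \<open>L - K\<close> discarded ones from
  the block all have the same size.
\<close>
lemma vertex_value:
  fixes U :: "complex^('n::{finite,linorder})^'p" and V :: "complex^('n::{finite,linorder})^'q"
  assumes svd: "is_svd F U \<phi> V" and JL: "1 \<le> J" "J \<le> K" "K \<le> L" "L \<le> CARD('n)"
    and block: "\<And>j. J \<le> j \<Longrightarrow> j \<le> L \<Longrightarrow> \<phi> j = \<phi> K"
    and y: "\<And>j. j \<in> {J..L} \<Longrightarrow> y j = 0 \<or> y j = 1" "(\<Sum>j=J..L. y j) = real (K + 1 - J)"
  shows "rank_functional K F (U ** diag_mat (splice \<phi> J L y) ** ctransp V)
           = ereal (\<Sum>j=K+1..CARD('n). (\<phi> j)\<^sup>2)"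
proof -
  note D = is_svdD[OF svd]
  let ?N = "CARD('n)" and ?A = "U ** diag_mat (splice \<phi> J L y) ** ctransp V"
  have "real (card {j\<in>{J..L}. y j = 1}) = (\<Sum>j=J..L. if y j = 1 then 1 else 0)"
    by (simp add: sum.If_cases Int_def)
  also have "\<dots> = real (K + 1 - J)" unfolding y(2)[symmetric] using y(1) by (intro sum.cong) auto
  finally have ones: "card {j\<in>{J..L}. y j = 1} = K + 1 - J" by linarith
  have "rank ?A = card {j\<in>{1..?N}. splice \<phi> J L y j \<noteq> 0}" by (rule rank_factored[OF D(1,2)])
  also have "\<dots> \<le> card ({1..<J} \<union> {j\<in>{J..L}. y j = 1})"
  proof (intro card_mono subsetI)
    fix j assume "j \<in> {j\<in>{1..?N}. splice \<phi> J L y j \<noteq> 0}"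
    then show "j \<in> {1..<J} \<union> {j\<in>{J..L}. y j = 1}"
      using y(1)[of j] by (auto simp: splice_def split: if_splits)
  qed auto
  also have "\<dots> \<le> card {1..<J} + card {j\<in>{J..L}. y j = 1}" by (rule card_Un_le)
  also have "\<dots> = K" using ones JL by simp
  finally have rank: "rank ?A \<le> K" .
  have "(norm (?A - F))\<^sup>2 = (\<Sum>j=1..?N. (splice \<phi> J L y j - \<phi> j)\<^sup>2)"
    unfolding D(3) by (rule factored_distance[OF D(1,2)])
  also have "\<dots> = (\<Sum>j=1..<J. (splice \<phi> J L y j - \<phi> j)\<^sup>2) + (\<Sum>j=J..L. (splice \<phi> J L y j - \<phi> j)\<^sup>2)
      + (\<Sum>j=L+1..?N. (splice \<phi> J L y j - \<phi> j)\<^sup>2)"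
    using JL by (intro block_sums) auto
  also have "(\<Sum>j=1..<J. (splice \<phi> J L y j - \<phi> j)\<^sup>2) = 0" by (simp add: splice_def)
  also have "(\<Sum>j=J..L. (splice \<phi> J L y j - \<phi> j)\<^sup>2) = (\<Sum>j=J..L. (\<phi> K)\<^sup>2 * (1 - y j))"
  proof (intro sum.cong refl)
    fix j assume j: "j \<in> {J..L}"
    then have "\<phi> j = \<phi> K" by (intro block) auto
    then show "(splice \<phi> J L y j - \<phi> j)\<^sup>2 = (\<phi> K)\<^sup>2 * (1 - y j)"
      using j y(1)[OF j] by (auto simp: splice_def)
  qed
  also have "\<dots> = (\<phi> K)\<^sup>2 * (real (L + 1 - J) - real (K + 1 - J))"
    using y(2) by (simp only: sum_distrib_left[symmetric] sum_subtractf) simp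
  also have "\<dots> = (\<phi> K)\<^sup>2 * real (L - K)" using JL by (simp add: of_nat_diff)
  also have "\<dots> = (\<Sum>j=K+1..L. (\<phi> j)\<^sup>2)"
  proof -
    have "(\<Sum>j=K+1..L. (\<phi> j)\<^sup>2) = (\<Sum>j=K+1..L. (\<phi> K)\<^sup>2)"
    proof (intro sum.cong refl)
      fix j assume "j \<in> {K+1..L}"
      then have "\<phi> j = \<phi> K" using JL by (intro block) auto
      then show "(\<phi> j)\<^sup>2 = (\<phi> K)\<^sup>2" by simp
    qed
    then show ?thesis by simp
  qed
  also have "(\<Sum>j=L+1..?N. (splice \<phi> J L y j - \<phi> j)\<^sup>2) = (\<Sum>j=L+1..?N. (\<phi> j)\<^sup>2)"
    using JL by (intro sum.cong) (auto simp: splice_def)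
  also have "0 + (\<Sum>j=K+1..L. (\<phi> j)\<^sup>2) + (\<Sum>j=L+1..?N. (\<phi> j)\<^sup>2) = (\<Sum>j=K+1..?N. (\<phi> j)\<^sup>2)"
    using tail_energy[of K ?N \<phi>] tail_energy[of L ?N \<phi>] tail_energy[of K L \<phi>] JL by simp
  finally have "(norm (?A - F))\<^sup>2 = (\<Sum>j=K+1..?N. (\<phi> j)\<^sup>2)" .
  then show ?thesis using rank by (simp add: rank_functional_def rank_indicator_def)
qed

lemma optimal_sequence_value:
  fixes U :: "complex^('n::{finite,linorder})^'p" and V :: "complex^('n::{finite,linorder})^'q"
  assumes svd: "is_svd F U \<phi> V" and JL: "1 \<le> J" "J \<le> K" "K \<le> L" "L \<le> CARD('n)"
    and block: "\<And>j. J \<le> j \<Longrightarrow> j \<le> L \<Longrightarrow> \<phi> j = \<phi> K"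
    and \<alpha>: "\<alpha> \<in> optimal_sequences \<phi> CARD('n) K J L"
  shows "convex_envelope (rank_functional K F) (U ** diag_mat \<alpha> ** ctransp V)
           \<le> ereal (\<Sum>j=K+1..CARD('n). (\<phi> j)\<^sup>2)"
proof -
  obtain y where y: "\<And>j. j \<in> {J..L} \<Longrightarrow> 0 \<le> y j \<and> y j \<le> 1" "(\<Sum>j=J..L. y j) = real (K + 1 - J)"
    and eq: "\<And>j. j \<in> {1..CARD('n)} \<Longrightarrow> \<alpha> j = splice \<phi> J L y j"
    using optimal_sequence_splice[OF \<alpha> JL block] by blast
  let ?env = "convex_envelope (rank_functional K F)" and ?c = "\<Sum>j=K+1..CARD('n). (\<phi> j)\<^sup>2"
  have "?env (U ** diag_mat (splice \<phi> J L y) ** ctransp V) \<le> ereal ?c"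
  proof (rule hypersimplex_vertices[where A = "{J..L}" and x = y and k = "K + 1 - J"])
    fix u v :: "nat \<Rightarrow> real" and t :: real
    assume uv: "?env (U ** diag_mat (splice \<phi> J L u) ** ctransp V) \<le> ereal ?c"
      "?env (U ** diag_mat (splice \<phi> J L v) ** ctransp V) \<le> ereal ?c" and t: "0 \<le> t" "t \<le> 1"
    have "splice \<phi> J L (\<lambda>j. (1 - t) * u j + t * v j)
        = (\<lambda>j. (1 - t) * splice \<phi> J L u j + t * splice \<phi> J L v j)"
      by (rule ext) (simp add: splice_def algebra_simps)
    then show "?env (U ** diag_mat (splice \<phi> J L (\<lambda>j. (1 - t) * u j + t * v j)) ** ctransp V) \<le> ereal ?c"
      using convex_sublevel[OF convex_envelope_greatest(1) uv t] by (simp only: factored_affine)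
  next
    fix z :: "nat \<Rightarrow> real"
    assume z: "\<And>j. j \<in> {J..L} \<Longrightarrow> z j = 0 \<or> z j = 1" "(\<Sum>j\<in>{J..L}. z j) = real (K + 1 - J)"
    have "?env (U ** diag_mat (splice \<phi> J L z) ** ctransp V)
        \<le> rank_functional K F (U ** diag_mat (splice \<phi> J L z) ** ctransp V)"
      using convex_envelope_greatest(2)[of "rank_functional K F"] by (simp add: le_fun_def)
    also have "\<dots> = ereal ?c" by (rule vertex_value[OF svd JL block z])
    finally show "?env (U ** diag_mat (splice \<phi> J L z) ** ctransp V) \<le> ereal ?c" .
  qed (use y in auto)
  moreover have "diag_mat \<alpha> = (diag_mat (splice \<phi> J L y) :: complex^('n::{finite,linorder})^('n::{finite,linorder}))"
    using eq by (rule diag_mat_cong)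
  ultimately show ?thesis by simp
qed

text \<open>
  Write \<open>A = U \<Sigma> H V\<^sup>*\<close> and \<open>H = X D X\<^sup>*\<close> with \<open>X\<close> commuting with \<open>\<Sigma>\<close>. Then \<open>(U X, V X)\<close> is again a
  singular value decomposition of \<open>F\<close>, and \<open>A = (U X) \<Sigma> D (V X)\<^sup>*\<close>.
\<close>
lemma minimiser_has_optimal_svd:
  fixes U :: "complex^('n::{finite,linorder})^'p" and V :: "complex^('n::{finite,linorder})^'q"
  assumes svd: "is_svd F U \<phi> V" and N: "N = CARD('n)" and K: "1 \<le> K" "K \<le> N"
    and J: "J = Min {j\<in>{1..N}. \<phi> j = \<phi> K}" and L: "L = Max {j\<in>{1..N}. \<phi> j = \<phi> K}"
    and A: "convex_envelope (rank_functional K F) A \<le> ereal (\<Sum>j=K+1..N. (\<phi> j)\<^sup>2)"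
  shows "\<exists>(U' :: complex^('n::{finite,linorder})^'p) (V' :: complex^('n::{finite,linorder})^'q) \<alpha>.
           A = U' ** diag_mat \<alpha> ** ctransp V' \<and> is_svd F U' \<phi> V' \<and>
           \<alpha> \<in> optimal_sequences \<phi> N K J L"
proof -
  note D = is_svdD[OF svd]
  have anti: "antimono_on {1..N} \<phi>" and nn: "\<And>j. j \<in> {1..N} \<Longrightarrow> 0 \<le> \<phi> j" using D(4,5) N by auto
  note B = multiplicity_block[OF anti K J L]
  note An = envelope_analysis(2)[OF svd N K A]
  show ?thesis
  proof (cases "\<phi> K = 0")
    case True
    \<comment> \<open>Here the weights on the block do not affect \<open>\<alpha>\<close>; any point of the simplex will do.\<close>
    define y where "y j = (if j \<le> K then 1 else 0 :: real)" for j
    have "(\<Sum>j=J..L. y j) = (\<Sum>j\<in>{J..K}. 1)"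
      unfolding y_def using B(2,3) by (intro sum.mono_neutral_cong_right) auto
    then have sum_y: "(\<Sum>j=J..L. y j) = real (K + 1 - J)" by simp
    have "antimono_on {J..L} y" and "0 \<le> y j \<and> y j \<le> 1" for j
      by (auto simp: y_def monotone_on_def)
    from splice_optimal[OF anti nn B(1-4,6) this sum_y]
    have "splice \<phi> J L y \<in> optimal_sequences \<phi> N K J L" .
    moreover have "diag_mat \<phi> = (diag_mat (splice \<phi> J L y) :: complex^('n::{finite,linorder})^('n::{finite,linorder}))"
    proof (rule diag_mat_cong)
      fix j assume "j \<in> {1..CARD('n)}"
      then show "\<phi> j = splice \<phi> J L y j"
        using B(6)[of j] B(7)[of j] nn[of j] True N by (auto simp: splice_def not_le)
    qed
    ultimately show ?thesis using True An svd D(3) by metis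
  next
    case False
    then have s: "0 < \<phi> K" using nn[of K] K by auto
    then obtain H where H: "H \<in> relaxed_projections K" and AH: "A = U ** diag_mat \<phi> ** H ** ctransp V"
      and top: "\<And>i. \<phi> K < \<phi> (pos i) \<Longrightarrow> H *v axis i 1 = axis i 1"
      and bot: "\<And>i. \<phi> (pos i) < \<phi> K \<Longrightarrow> H *v axis i 1 = 0" and tr: "Re (trace H) = real K"
      using An by blast
    have top': "H *v axis i 1 = axis i 1" if "pos i < J" for i
      using B(5)[OF pos_range(1) that] by (rule top)
    have bot': "H *v axis i 1 = 0" if "L < pos i" for i
      using B(7)[OF that] pos_range(2)[of i] N by (intro bot) auto
    have JL: "1 \<le> J" "J \<le> L" "L \<le> CARD('n)" using B(1-4) N by auto
    obtain X :: "complex^('n::{finite,linorder})^('n::{finite,linorder})" and d where X: "ctransp X ** X = mat 1" and HX: "H = X ** diag_mat d ** ctransp X"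
      and d1: "\<And>j. j < J \<Longrightarrow> d j = 1" and d0: "\<And>j. L < j \<Longrightarrow> d j = 0" and d: "antimono_on {J..L} d"
      and comm': "\<And>\<psi>. (\<forall>j\<in>{J..L}. \<psi> j = \<psi> J) \<Longrightarrow> diag_mat \<psi> ** X = X ** diag_mat \<psi>"
      using block_diagonalisation[OF relaxed_projectionsD(1)[OF H] JL top' bot'] by blast
    have comm: "diag_mat \<phi> ** X = X ** diag_mat \<phi>"
    proof (rule comm', intro ballI)
      fix j assume "j \<in> {J..L}"
      then show "\<phi> j = \<phi> J" using B(6)[of j] B(6)[of J] JL(2) by simp
    qed
    have X': "X ** ctransp X = mat 1" using X by (simp add: matrix_left_right_inverse)
    define U' where "U' = U ** X"
    define V' where "V' = V ** X"
    have commX: "diag_mat \<phi> ** ctransp X = ctransp X ** diag_mat \<phi>"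
    proof -
      have "ctransp (diag_mat \<phi> ** X) = ctransp (X ** diag_mat \<phi>)" by (simp only: comm)
      then show ?thesis by (simp only: ctransp_mult ctransp_diag_mat)
    qed
    have "ctransp U' ** U' = ctransp X ** (ctransp U ** U) ** X"
      by (simp only: U'_def ctransp_mult matrix_mul_assoc)
    then have "ctransp U' ** U' = mat 1" by (simp add: D(1) X)
    moreover have "ctransp V' ** V' = ctransp X ** (ctransp V ** V) ** X"
      by (simp only: V'_def ctransp_mult matrix_mul_assoc)
    then have "ctransp V' ** V' = mat 1" by (simp add: D(2) X)
    moreover have "U' ** diag_mat \<phi> ** ctransp V' = U ** (X ** diag_mat \<phi>) ** ctransp X ** ctransp V"
      by (simp only: U'_def V'_def ctransp_mult matrix_mul_assoc)
    then have "U' ** diag_mat \<phi> ** ctransp V' = U ** diag_mat \<phi> ** (X ** ctransp X) ** ctransp V"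
      by (simp only: comm[symmetric] matrix_mul_assoc)
    then have "F = U' ** diag_mat \<phi> ** ctransp V'" by (simp add: X' D(3)[symmetric])
    ultimately have svd': "is_svd F U' \<phi> V'" using svd unfolding is_svd_def by blast
    have "A = U ** (diag_mat \<phi> ** X) ** diag_mat d ** ctransp X ** ctransp V"
      by (simp only: AH HX matrix_mul_assoc)
    then have "A = U' ** (diag_mat \<phi> ** diag_mat d) ** ctransp V'"
      by (simp only: comm U'_def V'_def ctransp_mult matrix_mul_assoc)
    then have A': "A = U' ** diag_mat (\<lambda>j. \<phi> j * d j) ** ctransp V'"
      by (simp only: diag_mat_mult)
    have d01: "0 \<le> d j \<and> d j \<le> 1" if j: "j \<in> {J..L}" for j
    proof -
      have "j \<in> {1..CARD('n)}" using j JL by auto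
      then obtain i :: 'n where i: "pos i = j"
        using bij_betw_pos[where 'n = 'n] by (auto simp: bij_betw_def set_eq_iff image_iff) metis
      let ?D = "diag_mat d :: complex^('n::{finite,linorder})^('n::{finite,linorder})"
      have "ctransp X ** H ** X = (ctransp X ** X) ** ?D ** (ctransp X ** X)"
        by (simp only: HX matrix_mul_assoc)
      then have "?D \<in> relaxed_projections K" using compression_relaxed[OF H X] by (simp add: X)
      then have "0 \<le> Re (?D $ i $ i) \<and> Re (?D $ i $ i) \<le> 1"
        using compression_diagonal(1,2)[of ?D K i] by blast
      then show ?thesis by (simp add: diag_mat_def i)
    qed
    have "trace H = trace (ctransp X ** (X ** diag_mat d))"
      unfolding HX by (rule trace_mul_sym)
    also have "\<dots> = trace (diag_mat d :: complex^('n::{finite,linorder})^('n::{finite,linorder}))" by (simp add: matrix_mul_assoc X)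
    also have "\<dots> = of_real (\<Sum>j=1..N. d j)"
      using sum_pos[of d, where 'n = 'n] by (simp add: trace_def diag_mat_def N flip: of_real_sum)
    finally have "(\<Sum>j=1..N. d j) = real K" using tr by simp
    moreover have "(\<Sum>j=1..N. d j) = (\<Sum>j=1..<J. d j) + (\<Sum>j=J..L. d j) + (\<Sum>j=L+1..N. d j)"
      using JL N by (intro block_sums) auto
    ultimately have sum_d: "(\<Sum>j=J..L. d j) = real (K + 1 - J)"
      using d1 d0 B(1,2) by (simp add: of_nat_diff)
    have "splice \<phi> J L d \<in> optimal_sequences \<phi> N K J L"
      by (rule splice_optimal[OF anti nn B(1-4,6) d d01 sum_d])
    moreover have "diag_mat (\<lambda>j. \<phi> j * d j) = (diag_mat (splice \<phi> J L d) :: complex^('n::{finite,linorder})^('n::{finite,linorder}))"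
      by (rule diag_mat_cong) (auto simp: splice_def d1 d0)
    ultimately show ?thesis using A' svd' by metis
  qed
qed

text \<open>
  If \<open>\<phi> K\<close> is larger than the next singular value, then at most \<open>K\<close> of the weights are nonzero, each is
  at most \<open>1\<close>, and their sum is \<open>K\<close>; hence they are all \<open>1\<close> and \<open>H\<close> is determined.
\<close>
lemma minimiser_unique:
  fixes U :: "complex^('n::{finite,linorder})^'p" and V :: "complex^('n::{finite,linorder})^'q"
  assumes svd: "is_svd F U \<phi> V" and N: "N = CARD('n)" and K: "1 \<le> K" "K \<le> N"
    and LK: "\<And>j. K < j \<Longrightarrow> j \<le> N \<Longrightarrow> \<phi> j < \<phi> K" and s: "0 < \<phi> K"
    and A: "convex_envelope (rank_functional K F) A \<le> ereal (\<Sum>j=K+1..N. (\<phi> j)\<^sup>2)"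
  shows "A = U ** diag_mat (\<lambda>j. if j \<le> K then \<phi> j else 0) ** ctransp V"
proof -
  obtain H where H: "H \<in> relaxed_projections K" and AH: "A = U ** diag_mat \<phi> ** H ** ctransp V"
    and bot: "\<And>i. \<phi> (pos i) < \<phi> K \<Longrightarrow> H *v axis i 1 = 0" and tr: "Re (trace H) = real K"
    using envelope_analysis(2)[OF svd N K A] s by blast
  let ?P = "diag_mat (\<lambda>j. if j \<le> K then 1 else 0) :: complex^('n::{finite,linorder})^('n::{finite,linorder})"
  have zero: "H *v axis i 1 = 0" if "K < pos i" for i
    using LK[OF that] pos_range(2)[of i] N by (intro bot) auto
  have gap: "Re (H $ i $ i) \<le> Re (?P $ i $ i)" for i
  proof (cases "pos i \<le> K")
    case True
    then show ?thesis using compression_diagonal(2)[OF H, of i] by (simp add: diag_mat_def)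
  next
    case False
    then have "column i H = 0" using zero[of i] by (simp add: mult_axis)
    then have "H $ i $ i = 0" by (simp add: column_def vec_eq_iff)
    then show ?thesis by (simp add: diag_mat_def)
  qed
  have "(\<Sum>i\<in>UNIV. Re (?P $ i $ i)) = (\<Sum>j=1..N. if j \<le> K then 1 else 0)"
    using sum_pos[of "\<lambda>j. if j \<le> K then 1 else 0 :: real", where 'n = 'n]
    by (simp add: diag_mat_def N if_distrib[of Re] cong: if_cong)
  also have "\<dots> = (\<Sum>j\<in>{1..K}. 1)" using K by (intro sum.mono_neutral_cong_right) auto
  also have "\<dots> = (\<Sum>i\<in>UNIV. Re (H $ i $ i))" using tr by (simp add: trace_def)
  finally have "(\<Sum>i\<in>UNIV. Re (?P $ i $ i) - Re (H $ i $ i)) = 0" by (simp add: sum_subtractf)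
  then have diag: "Re (H $ i $ i) = Re (?P $ i $ i)" for i
    using gap by (subst (asm) sum_nonneg_eq_0_iff) auto
  have H_axis: "H *v axis i 1 = (if pos i \<le> K then axis i 1 else 0)" for i
    using zero[of i] compression_diagonal(3)[OF H, of i] diag[of i] by (simp add: diag_mat_def)
  have "column i H = column i ?P" for i
  proof -
    have "column i ?P = (if pos i \<le> K then axis i 1 else 0)"
      by (auto simp: column_def vec_eq_iff diag_mat_def axis_def)
    then show ?thesis using H_axis[of i] by (simp add: mult_axis)
  qed
  then have "H = ?P" by (rule matrix_eq_columnsI)
  then have "A = U ** (diag_mat \<phi> ** ?P) ** ctransp V" by (simp only: AH matrix_mul_assoc)
  also have "diag_mat \<phi> ** ?P = diag_mat (\<lambda>j. if j \<le> K then \<phi> j else 0)"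
    by (simp add: diag_mat_mult if_distrib[of "\<lambda>z. _ * z"] cong: if_cong)
  finally show ?thesis .
qed

section \<open>Ranks, uniqueness and the conclusion\<close>

text \<open>
  The entries before \<open>J\<close> exceed \<open>\<phi> K > 0\<close> and never vanish; in the block the weights decide.
\<close>
lemma rank_optimal:
  fixes U :: "complex^('n::{finite,linorder})^'p" and V :: "complex^('n::{finite,linorder})^'q"
  assumes svd: "is_svd F U \<phi> V" and JL: "1 \<le> J" "J \<le> K" "K \<le> L" "L \<le> CARD('n)"
    and block: "\<And>j. J \<le> j \<Longrightarrow> j \<le> L \<Longrightarrow> \<phi> j = \<phi> K"
    and top: "\<And>j. 1 \<le> j \<Longrightarrow> j < J \<Longrightarrow> \<phi> K < \<phi> j" and s: "0 < \<phi> K"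
    and eq: "\<And>j. j \<in> {1..CARD('n)} \<Longrightarrow> \<alpha> j = splice \<phi> J L y j"
  shows "rank (U ** diag_mat \<alpha> ** ctransp V) = J - 1 + card {j\<in>{J..L}. y j \<noteq> 0}"
proof -
  have "rank (U ** diag_mat \<alpha> ** ctransp V) = card {j\<in>{1..CARD('n)}. \<alpha> j \<noteq> 0}"
    by (rule rank_factored[OF is_svdD(1,2)[OF svd]])
  also have "{j\<in>{1..CARD('n)}. \<alpha> j \<noteq> 0} = {1..<J} \<union> {j\<in>{J..L}. y j \<noteq> 0}"
  proof (intro set_eqI)
    fix j
    consider "j < 1 \<or> CARD('n) < j" | "1 \<le> j" "j < J" | "J \<le> j" "j \<le> L" | "L < j" "j \<le> CARD('n)"
      by linarith
    then show "j \<in> {j\<in>{1..CARD('n)}. \<alpha> j \<noteq> 0} \<longleftrightarrow> j \<in> {1..<J} \<union> {j\<in>{J..L}. y j \<noteq> 0}"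
    proof cases
      case 1
      then show ?thesis using JL by auto
    next
      case 2
      then show ?thesis using JL eq[of j] top[of j] s by (simp add: splice_def)
    next
      case 3
      then show ?thesis using JL eq[of j] block[of j] s by (simp add: splice_def)
    next
      case 4
      then show ?thesis using JL eq[of j] by (simp add: splice_def)
    qed
  qed
  also have "card ({1..<J} \<union> {j\<in>{J..L}. y j \<noteq> 0}) = card {1..<J} + card {j\<in>{J..L}. y j \<noteq> 0}"
    by (rule card_Un_disjoint) auto
  finally show ?thesis by simp
qed

theorem theorem2:
  fixes F :: "complex^'q^'p" and \<phi> :: "nat \<Rightarrow> real" and K N J L M m :: nat
    and I I' :: "complex^'q^'p \<Rightarrow> ereal"
  assumes card_n: "CARD('n::{finite,linorder}) = N"
    and N: "N = min CARD('p) CARD('q)"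
    and K: "1 \<le> K" "K < N"
    and \<phi>: "singular_values F \<phi>"
    and J: "J = Min {j\<in>{1..N}. \<phi> j = \<phi> K}"
    and L: "L = Max {j\<in>{1..N}. \<phi> j = \<phi> K}"
    and M: "M = L + 1 - J"
    and m: "m = K + 1 - J"
    and I: "I = rank_functional K F"
    and I': "I' = convex_envelope I"
  shows "has_global_min I (ereal (\<Sum>j=K+1..N. (\<phi> j)\<^sup>2))
       \<and> has_global_min I' (ereal (\<Sum>j=K+1..N. (\<phi> j)\<^sup>2))
       \<and> argmin I' =
          {U ** diag_mat \<alpha> ** ctransp V |
             (U :: complex^('n::{finite,linorder})^'p) (V :: complex^('n::{finite,linorder})^'q) \<alpha>.
             is_svd F U \<phi> V \<and> antimono_on {1..N} \<alpha> \<and>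
             (\<forall>j. 1 \<le> j \<and> j < J \<longrightarrow> \<alpha> j = \<phi> j) \<and>
             (\<exists>x\<in>Omega M m. \<forall>i\<in>{1..M}. \<alpha> (J + i - 1) = \<phi> K * x i) \<and>
             (\<forall>j. L < j \<and> j \<le> N \<longrightarrow> \<alpha> j = 0)}
       \<and> (M = 1 \<longrightarrow> (\<exists>!A. A \<in> argmin I'))
       \<and> ((\<exists>!A. A \<in> argmin I') \<longleftrightarrow> L = K \<or> \<phi> K = 0)
       \<and> (0 < \<phi> K \<longrightarrow>
            (\<exists>A\<in>argmin I'. rank A = L) \<and> (\<forall>A\<in>argmin I'. rank A \<le> L) \<and>
            (\<exists>A\<in>argmin I'. rank A = K) \<and> (\<forall>A\<in>argmin I'. K \<le> rank A))
       \<and> (0 < \<phi> K \<and> J = K \<longrightarrow>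
            ((\<exists>!A. A \<in> argmin I') \<longleftrightarrow> M = 1) \<and>
            (\<exists>A\<in>argmin I'. rank A = J) \<and> (\<forall>A\<in>argmin I'. J \<le> rank A))"
proof -
  define c where "c = (\<Sum>j=K+1..N. (\<phi> j)\<^sup>2)"
  have KN: "1 \<le> K" "K \<le> N" using K by auto
  have Nn: "N = CARD('n)" using card_n by simp
  have "CARD('n) = min CARD('p) CARD('q)" using card_n N by simp
  from svd_exists[OF \<phi> this] obtain U :: "complex^('n::{finite,linorder})^'p" and V :: "complex^('n::{finite,linorder})^'q"
    where svd: "is_svd F U \<phi> V" by blast
  have anti: "antimono_on {1..N} \<phi>" and nn: "\<And>j. j \<in> {1..N} \<Longrightarrow> 0 \<le> \<phi> j"
    using is_svdD(4,5)[OF svd] Nn by auto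
  note B = multiplicity_block[OF anti KN J L]
  have LN: "L \<le> CARD('n)" using B(4) Nn by simp
  define E where "E y = U ** diag_mat (splice \<phi> J L y) ** ctransp V" for y
  have env: "I' = convex_envelope (rank_functional K F)" by (simp add: I I')
  have lower: "ereal c \<le> I' A" for A
    unfolding c_def env by (rule envelope_analysis(1)[OF svd Nn KN])
  have I'_le: "I' A \<le> I A" for A
    using convex_envelope_greatest(2)[of I] by (simp add: I' le_fun_def)
  have env_le: "I' (E y) \<le> ereal c"
    if "antimono_on {J..L} y" "\<And>j. j \<in> {J..L} \<Longrightarrow> 0 \<le> y j \<and> y j \<le> 1" "(\<Sum>j=J..L. y j) = real (K + 1 - J)" for y
    unfolding c_def env E_def Nn
    by (rule optimal_sequence_value[OF svd B(1-3) LN B(6)])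
      (use splice_optimal[OF anti nn B(1-4,6) that] Nn in simp_all)
  \<comment> \<open>The plain truncation \<open>\<phi> 1, \<dots>, \<phi> K, 0, \<dots>, 0\<close>, a common minimiser of \<open>I\<close> and \<open>I'\<close>.\<close>
  define y1 where "y1 j = (if j \<le> K then 1 else 0 :: real)" for j
  have y1: "antimono_on {J..L} y1" "0 \<le> y1 j \<and> y1 j \<le> 1" "y1 j = 0 \<or> y1 j = 1"
    "(\<Sum>j=J..L. y1 j) = real (K + 1 - J)" for j
  proof -
    have "(\<Sum>j=J..L. y1 j) = (\<Sum>j\<in>{J..K}. 1)"
      unfolding y1_def using B(2,3) by (intro sum.mono_neutral_cong_right) auto
    then show "(\<Sum>j=J..L. y1 j) = real (K + 1 - J)" by simp
  qed (auto simp: y1_def monotone_on_def)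
  have IE: "I (E y1) = ereal c"
    unfolding I E_def c_def Nn by (rule vertex_value[OF svd B(1-3) LN B(6) y1(3,4)])
  have argmin_I': "A \<in> argmin I' \<longleftrightarrow> I' A \<le> ereal c" for A
  proof
    assume "A \<in> argmin I'"
    then have "I' A \<le> I' (E y1)" by (auto simp: argmin_def is_arg_min_def not_less)
    also have "\<dots> \<le> ereal c" using I'_le[of "E y1"] IE by simp
    finally show "I' A \<le> ereal c" .
  next
    assume "I' A \<le> ereal c"
    then have "\<not> I' B < I' A" for B using lower[of B] by (meson leD order.trans)
    then show "A \<in> argmin I'" by (auto simp: argmin_def is_arg_min_def)
  qed
  have E1: "E y1 \<in> argmin I'" using I'_le[of "E y1"] IE by (simp add: argmin_I')
  have min_I: "has_global_min I (ereal c)"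
  proof -
    have "\<not> I A < I (E y1)" for A
      unfolding IE using order.trans[OF lower I'_le, of A] by (simp add: not_less)
    then have "E y1 \<in> argmin I" by (simp add: argmin_def is_arg_min_def)
    then show ?thesis unfolding has_global_min_def using IE by blast
  qed
  have min_I': "has_global_min I' (ereal c)"
  proof -
    have "I' (E y1) = ereal c" using E1 lower[of "E y1"] argmin_I'[of "E y1"] by (simp add: antisym)
    then show ?thesis unfolding has_global_min_def using E1 by blast
  qed
  define T where "T = {U ** diag_mat \<alpha> ** ctransp V | (U :: complex^('n::{finite,linorder})^'p)
      (V :: complex^('n::{finite,linorder})^'q) \<alpha>. is_svd F U \<phi> V \<and> \<alpha> \<in> optimal_sequences \<phi> N K J L}"
  have argmin_T: "argmin I' = T"
  proof (intro set_eqI iffI)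
    fix A assume "A \<in> argmin I'"
    then have "convex_envelope (rank_functional K F) A \<le> ereal (\<Sum>j=K+1..N. (\<phi> j)\<^sup>2)"
      unfolding argmin_I' unfolding env c_def .
    from minimiser_has_optimal_svd[OF svd Nn KN J L this] show "A \<in> T" unfolding T_def by blast
  next
    fix A assume "A \<in> T"
    then obtain U' :: "complex^('n::{finite,linorder})^'p" and V' :: "complex^('n::{finite,linorder})^'q" and \<alpha>
      where A: "A = U' ** diag_mat \<alpha> ** ctransp V'" "is_svd F U' \<phi> V'"
        and \<alpha>: "\<alpha> \<in> optimal_sequences \<phi> CARD('n) K J L" unfolding T_def Nn by blast
    show "A \<in> argmin I'"
      unfolding argmin_I' unfolding A(1) env c_def Nn by (rule optimal_sequence_value[OF A(2) B(1-3) LN B(6) \<alpha>])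
  qed
  have ranks: "K \<le> rank A \<and> rank A \<le> L" if s: "0 < \<phi> K" and A: "A \<in> argmin I'" for A
  proof -
    obtain U' :: "complex^('n::{finite,linorder})^'p" and V' :: "complex^('n::{finite,linorder})^'q" and \<alpha>
      where A': "A = U' ** diag_mat \<alpha> ** ctransp V'" "is_svd F U' \<phi> V'"
        and \<alpha>: "\<alpha> \<in> optimal_sequences \<phi> N K J L" using A unfolding argmin_T T_def by blast
    obtain y where y: "\<And>j. j \<in> {J..L} \<Longrightarrow> 0 \<le> y j \<and> y j \<le> 1" "(\<Sum>j=J..L. y j) = real (K + 1 - J)"
      and eq: "\<And>j. j \<in> {1..N} \<Longrightarrow> \<alpha> j = splice \<phi> J L y j"
      using optimal_sequence_splice[OF \<alpha> B(1-4,6)] by blast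
    have r: "rank A = J - 1 + card {j\<in>{J..L}. y j \<noteq> 0}"
      unfolding A'(1) using eq Nn by (intro rank_optimal[OF A'(2) B(1-3) LN B(6,5) s]) simp_all
    have "real (K + 1 - J) \<le> (\<Sum>j=J..L. if y j \<noteq> 0 then 1 else 0)"
      unfolding y(2)[symmetric] using y(1) by (intro sum_mono) auto
    also have "\<dots> = real (card {j\<in>{J..L}. y j \<noteq> 0})" by (simp add: sum.If_cases Int_def)
    finally have "K + 1 - J \<le> card {j\<in>{J..L}. y j \<noteq> 0}" by linarith
    moreover have "card {j\<in>{J..L}. y j \<noteq> 0} \<le> card {J..L}" by (intro card_mono) auto
    ultimately show ?thesis using r B(1-3) by auto
  qed
  have rank_E: "rank (E y) = J - 1 + card {j\<in>{J..L}. y j \<noteq> 0}" if "0 < \<phi> K" for y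
    unfolding E_def by (rule rank_optimal[OF svd B(1-3) LN B(6,5) that refl])
  have rank_K: "\<exists>A\<in>argmin I'. rank A = K" if s: "0 < \<phi> K"
  proof -
    have "{j\<in>{J..L}. y1 j \<noteq> 0} = {J..K}" using B(3) by (auto simp: y1_def)
    then have "rank (E y1) = K" using rank_E[OF s, of y1] B(1,2) by simp
    then show ?thesis using E1 by blast
  qed
  have rank_L: "\<exists>A\<in>argmin I'. rank A = L" if s: "0 < \<phi> K"
  proof -
    \<comment> \<open>Spreading the weight evenly over the block makes all its entries positive.\<close>
    define t where "t = real (K + 1 - J) / real (L + 1 - J)"
    have t: "0 < t" "t \<le> 1" using B(1-3) by (auto simp: t_def)
    have "(\<Sum>j=J..L. t) = real (K + 1 - J)" using B(2,3) by (simp add: t_def)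
    then have "I' (E (\<lambda>j. t)) \<le> ereal c" using t by (intro env_le) (auto simp: monotone_on_def)
    moreover have "rank (E (\<lambda>j. t)) = L"
    proof -
      have "{j\<in>{J..L}. t \<noteq> 0} = {J..L}" using t by auto
      then show ?thesis using rank_E[OF s, of "\<lambda>j. t"] B(1-3) by simp
    qed
    ultimately show ?thesis using argmin_I' by blast
  qed
  have unique: "(\<exists>!A. A \<in> argmin I') \<longleftrightarrow> L = K \<or> \<phi> K = 0"
  proof
    assume ex1: "\<exists>!A. A \<in> argmin I'"
    show "L = K \<or> \<phi> K = 0"
    proof (rule ccontr)
      assume n: "\<not> (L = K \<or> \<phi> K = 0)"
      then have "0 < \<phi> K" using nn[of K] KN by auto
      then show False using rank_K rank_L ex1 n by metis
    qed
  next
    assume LK: "L = K \<or> \<phi> K = 0"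
    have "\<exists>A0. \<forall>A\<in>argmin I'. A = A0"
    proof (cases "\<phi> K = 0")
      case True
      have "A = F" if "A \<in> argmin I'" for A
        using that envelope_analysis(2)[OF svd Nn KN, of A] True
        unfolding argmin_I' unfolding env c_def by blast
      then show ?thesis by blast
    next
      case False
      then have s: "0 < \<phi> K" using nn[of K] KN by auto
      have below: "\<phi> j < \<phi> K" if "K < j" "j \<le> N" for j using B(7)[of j] that LK False by auto
      have "A = U ** diag_mat (\<lambda>j. if j \<le> K then \<phi> j else 0) ** ctransp V" if "A \<in> argmin I'" for A
      proof (rule minimiser_unique[OF svd Nn KN _ s])
        show "convex_envelope (rank_functional K F) A \<le> ereal (\<Sum>j=K+1..N. (\<phi> j)\<^sup>2)"
          using that unfolding argmin_I' unfolding env c_def .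
      qed (rule below)
      then show ?thesis by blast
    qed
    then obtain A0 where "\<And>A. A \<in> argmin I' \<Longrightarrow> A = A0" by blast
    then show "\<exists>!A. A \<in> argmin I'" using E1 by (metis (full_types))
  qed
  have M1: "M = 1 \<longrightarrow> (\<exists>!A. A \<in> argmin I')" using unique B(1-3) M by auto
  have argmin_eq: "argmin I' =
          {U ** diag_mat \<alpha> ** ctransp V |
             (U :: complex^('n::{finite,linorder})^'p) (V :: complex^('n::{finite,linorder})^'q) \<alpha>.
             is_svd F U \<phi> V \<and> antimono_on {1..N} \<alpha> \<and>
             (\<forall>j. 1 \<le> j \<and> j < J \<longrightarrow> \<alpha> j = \<phi> j) \<and>
             (\<exists>x\<in>Omega M m. \<forall>i\<in>{1..M}. \<alpha> (J + i - 1) = \<phi> K * x i) \<and>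
             (\<forall>j. L < j \<and> j \<le> N \<longrightarrow> \<alpha> j = 0)}"
    unfolding argmin_T T_def optimal_sequences_def M m by simp
  have J_K: "0 < \<phi> K \<and> J = K \<longrightarrow> ((\<exists>!A. A \<in> argmin I') \<longleftrightarrow> M = 1) \<and>
            (\<exists>A\<in>argmin I'. rank A = J) \<and> (\<forall>A\<in>argmin I'. J \<le> rank A)"
  proof
    assume "0 < \<phi> K \<and> J = K"
    then have s: "0 < \<phi> K" and JK: "J = K" by auto
    have "M = 1 \<longleftrightarrow> L = K" using M JK B(3) by auto
    then have "(\<exists>!A. A \<in> argmin I') \<longleftrightarrow> M = 1" using unique s by simp
    then show "((\<exists>!A. A \<in> argmin I') \<longleftrightarrow> M = 1) \<and>
            (\<exists>A\<in>argmin I'. rank A = J) \<and> (\<forall>A\<in>argmin I'. J \<le> rank A)"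
      using rank_K[OF s] ranks[OF s] JK by (intro conjI) auto
  qed
  have all_ranks: "0 < \<phi> K \<longrightarrow>
            (\<exists>A\<in>argmin I'. rank A = L) \<and> (\<forall>A\<in>argmin I'. rank A \<le> L) \<and>
            (\<exists>A\<in>argmin I'. rank A = K) \<and> (\<forall>A\<in>argmin I'. K \<le> rank A)"
    using ranks rank_K rank_L by blast
  show ?thesis
    by (intro conjI min_I[unfolded c_def] min_I'[unfolded c_def] argmin_eq M1 unique all_ranks J_K)
qed

end
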